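(* Consider the AS-Log-GARCH$(p,q)$ model and the sequence of random matrices $\mathbf{C}=\{\boldsymbol{C}_t,\ t\in\mathbb{Z}\}$ defined in the context, with top Lyapunov exponent $\gamma(\mathbf{C})$. Assume that $E\log^+|\log\eta_0^2|<\infty$. A sufficient condition for the existence of a strictly stationary solution to the AS-Log-GARCH model is $\gamma(\mathbf{C})<0$. When $\gamma(\mathbf{C})<0$, there exists only one stationary solution, which is non anticipative and ergodic.
   Context: The AS-Log-GARCH$(p,q)$ model is $$\epsilon_t=\sigma_t\eta_t,\qquad \log \sigma_t^2=\omega+\sum_{i=1}^q\omega_{i-}1_{\{\epsilon_{t-i}<0\}}+\sum_{j=1}^p\beta_j\log \sigma_{t-j}^2+\sum_{i=1}^q\left(\alpha_{i+}1_{\{\epsilon_{t-i}>0\}}+\alpha_{i-}1_{\{\epsilon_{t-i}<0\}}\right)\log\epsilon_{t-i}^2,\quad t\in\mathbb{Z},$$ where $\sigma_t>0$, $(\eta_t)_{t\in\mathbb{Z}}$ is a sequence of iid random variables with $E\eta_1^2=1$, and all coefficients are real. Write $\boldsymbol{\alpha}_{+}=(\alpha_{1+},\dots,\alpha_{q+})'$, $\boldsymbol{\alpha}_{-}=(\alpha_{1-},\dots,\alpha_{q-})'$, $\boldsymbol{\beta}=(\beta_{1},\dots,\beta_{p})'$. Since coefficients equal to zero can always be added, it is assumed without restriction that $p>1$ and $q>1$. With $\boldsymbol I_k$ the $k\times k$ identity matrix, $\boldsymbol 0_k$ the null column vector of length $k$ and $\boldsymbol 0_{k\times l}$ the null $k\times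 l$ matrix, $\boldsymbol{C}_t$ is the $(2q+p)\times(2q+p)$ random matrix $$\boldsymbol{C}_t=\left(\begin{array}{ccc} 1_{\{\eta_{t}>0\}}\boldsymbol{\alpha}'_+&1_{\{\eta_{t}>0\}}\boldsymbol{\alpha}'_-&1_{\{\eta_{t}>0\}}\boldsymbol{\beta}' \\ (\boldsymbol{I}_{q-1}\ \ \boldsymbol{0}_{q-1}) &\boldsymbol{0}_{(q-1)\times q}&\boldsymbol{0}_{(q-1)\times p}\\ 1_{\{\eta_{t}<0\}}\boldsymbol{\alpha}'_+&1_{\{\eta_{t}<0\}}\boldsymbol{\alpha}'_-&1_{\{\eta_{t}<0\}}\boldsymbol{\beta}' \\ \boldsymbol{0}_{(q-1)\times q}&(\boldsymbol{I}_{q-1}\ \ \boldsymbol{0}_{q-1}) &\boldsymbol{0}_{(q-1)\times p}\\ \boldsymbol{\alpha}'_+&\boldsymbol{\alpha}'_-&\boldsymbol{\beta}' \\ \boldsymbol{0}_{(p-1)\times q} &\boldsymbol{0}_{(p-1)\times q}&(\boldsymbol{I}_{p-1}\ \ \boldsymbol{0}_{p-1}) \end{array}\right).$$ The top Lyapunov exponent is $$\gamma(\mathbf{C})=\lim_{t\to\infty}\frac1t E\left(\log\|\boldsymbol{C}_t\boldsymbol{C}_{t-1}\cdots\boldsymbol{C}_1\|\right)=\inf_{t\ge1}\frac1tE\left(\log\|\boldsymbol{C}_t\boldsymbol{C}_{t-1}\cdots\boldsymbol{C}_1\|\right)$$ for a matrix norm $\|\cdot\|$. A solution $(\epsilon_t)$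 is non anticipative if $\epsilon_t$ is measurable with respect to $\sigma(\{\eta_u, u\le t\})$ for every $t$. $\log^+x=\max(\log x,0)$. *)

theory Defs
  imports "HOL-Probability.Probability" "Jordan_Normal_Form.Matrix"
begin

text \<open>The logarithm with values in the extended reals, so that \<open>log 0 = -\<infinity>\<close>
  (whereas the library has \<open>ln 0 = 0\<close>). Both the norm of a matrix product and
  \<open>\<eta>\<^sub>t\<^sup>2\<close> may vanish.\<close>

definition ereal_log :: "ereal \<Rightarrow> ereal" where
  "ereal_log x = (if x \<le> 0 then -\<infinity> else if x = \<infinity> then \<infinity> else ereal (ln (real_of_ereal x)))"

definition ereal_log_plus :: "ereal \<Rightarrow> ereal" where
  "ereal_log_plus x = max (ereal_log x) 0"

text \<open>\<^const>\<open>e2ennreal\<close> maps negative numbers to \<open>0\<close>, so the two integrals below are those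
  of the positive and of the negative part.\<close>

definition ereal_expectation :: "'a measure \<Rightarrow> ('a \<Rightarrow> ereal) \<Rightarrow> ereal" where
  "ereal_expectation M f =
     enn2ereal (\<integral>\<^sup>+ x. e2ennreal (f x) \<partial>M) - enn2ereal (\<integral>\<^sup>+ x. e2ennreal (- f x) \<partial>M)"

definition matrix_norm :: "nat \<Rightarrow> (real mat \<Rightarrow> real) \<Rightarrow> bool" where
  "matrix_norm n N \<longleftrightarrow>
     (\<forall>A\<in>carrier_mat n n. N A \<ge> 0 \<and> (N A = 0 \<longleftrightarrow> A = 0\<^sub>m n n)) \<and>
     (\<forall>A\<in>carrier_mat n n. \<forall>c. N (c \<cdot>\<^sub>m A) = \<bar>c\<bar> * N A) \<and>
     (\<forall>A\<in>carrier_mat n n. \<forall>B\<in>carrier_mat n n. N (A + B) \<le> N A + N B) \<and>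
     (\<forall>A\<in>carrier_mat n n. \<forall>B\<in>carrier_mat n n. N (A * B) \<le> N A * N B)"

text \<open>\<open>C\<^sub>t C\<^sub>t\<^sub>-\<^sub>1 \<dots> C\<^sub>1\<close>\<close>

fun backward_prod :: "nat \<Rightarrow> (int \<Rightarrow> real mat) \<Rightarrow> nat \<Rightarrow> real mat" where
  "backward_prod n C 0 = 1\<^sub>m n"
| "backward_prod n C (Suc t) = C (int (Suc t)) * backward_prod n C t"

text \<open>The top Lyapunov exponent of a sequence of \<open>n \<times> n\<close> random matrices, with respect to
  the matrix norm \<open>N\<close>. For iid \<open>C\<close> with \<open>E log\<^sup>+ N(C\<^sub>1) < \<infinity>\<close> the sequence
  \<open>t \<mapsto> E log N(C\<^sub>t \<dots> C\<^sub>1)\<close> is subadditive, so that the infimum is also the limit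
  as \<open>t \<rightarrow> \<infinity>\<close>; the value \<open>-\<infinity>\<close> is possible.\<close>

definition top_lyapunov ::
  "'a measure \<Rightarrow> nat \<Rightarrow> (real mat \<Rightarrow> real) \<Rightarrow> (int \<Rightarrow> 'a \<Rightarrow> real mat) \<Rightarrow> ereal" where
  "top_lyapunov M n N C =
     (INF t\<in>{1::nat..}. ereal (1 / real t) *
        ereal_expectation M (\<lambda>x. ereal_log (ereal (N (backward_prod n (\<lambda>s. C s x) t)))))"

text \<open>The matrix \<open>C\<^sub>t\<close> at the realisation \<open>h\<close> of \<open>\<eta>\<^sub>t\<close>. Coefficients are functions on \<open>nat\<close>
  of which only the values at \<open>1, \<dots>, q\<close> (for \<open>\<beta>\<close>: \<open>1, \<dots>, p\<close>) are used, whereas matrix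
  entries are numbered from \<open>0\<close>. The rows \<open>0\<close>, \<open>q\<close>, \<open>2q\<close> are multiples of
  \<open>(\<alpha>\<^sub>+', \<alpha>\<^sub>-', \<beta>')\<close>; the blocks \<open>(I 0)\<close> below each of them sit on the diagonal
  of the block matrix, so that all other rows carry a single \<open>1\<close> just left of the diagonal.\<close>

definition as_log_garch_row ::
  "nat \<Rightarrow> (nat \<Rightarrow> real) \<Rightarrow> (nat \<Rightarrow> real) \<Rightarrow> (nat \<Rightarrow> real) \<Rightarrow> nat \<Rightarrow> real" where
  "as_log_garch_row q \<alpha>p \<alpha>m \<beta> j =
     (if j < q then \<alpha>p (j + 1)
      else if j < 2 * q then \<alpha>m (j - q + 1)
      else \<beta> (j - 2 * q + 1))"

definition as_log_garch_mat ::
  "nat \<Rightarrow> nat \<Rightarrow> (nat \<Rightarrow> real) \<Rightarrow> (nat \<Rightarrow> real) \<Rightarrow> (nat \<Rightarrow> real) \<Rightarrow> real \<Rightarrow> real mat" where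
  "as_log_garch_mat p q \<alpha>p \<alpha>m \<beta> h =
     mat (2 * q + p) (2 * q + p) (\<lambda>(i, j).
       if i = 0 then of_bool (h > 0) * as_log_garch_row q \<alpha>p \<alpha>m \<beta> j
       else if i = q then of_bool (h < 0) * as_log_garch_row q \<alpha>p \<alpha>m \<beta> j
       else if i = 2 * q then as_log_garch_row q \<alpha>p \<alpha>m \<beta> j
       else of_bool (i = j + 1))"

text \<open>When \<open>\<epsilon>\<^sub>t\<^sub>-\<^sub>i = 0\<close> both indicators in front of \<open>log \<epsilon>\<^sub>t\<^sub>-\<^sub>i\<^sup>2\<close> vanish; the convention
  \<open>0 \<cdot> log 0 = 0\<close> is the usual one.\<close>

definition as_log_garch_solution ::
  "'a measure \<Rightarrow> nat \<Rightarrow> nat \<Rightarrow> real \<Rightarrow> (nat \<Rightarrow> real) \<Rightarrow> (nat \<Rightarrow> real) \<Rightarrow> (nat \<Rightarrow> real) \<Rightarrow>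
     (nat \<Rightarrow> real) \<Rightarrow> (int \<Rightarrow> 'a \<Rightarrow> real) \<Rightarrow> (int \<Rightarrow> 'a \<Rightarrow> real) \<Rightarrow> bool" where
  "as_log_garch_solution M p q \<omega> \<omega>m \<alpha>p \<alpha>m \<beta> \<eta> \<epsilon> \<longleftrightarrow>
     (\<forall>t. \<epsilon> t \<in> borel_measurable M) \<and>
     (\<exists>\<sigma>. (\<forall>t. \<sigma> t \<in> borel_measurable M) \<and>
       (AE x in M. \<forall>t.
          \<sigma> t x > 0 \<and>
          \<epsilon> t x = \<sigma> t x * \<eta> t x \<and>
          ln ((\<sigma> t x)\<^sup>2) =
            \<omega> + (\<Sum>i=1..q. \<omega>m i * of_bool (\<epsilon> (t - int i) x < 0))
              + (\<Sum>j=1..p. \<beta> j * ln ((\<sigma> (t - int j) x)\<^sup>2))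
              + (\<Sum>i=1..q. (\<alpha>p i * of_bool (\<epsilon> (t - int i) x > 0)
                            + \<alpha>m i * of_bool (\<epsilon> (t - int i) x < 0))
                          * ln ((\<epsilon> (t - int i) x)\<^sup>2))))"

definition path_law :: "'a measure \<Rightarrow> (int \<Rightarrow> 'a \<Rightarrow> real) \<Rightarrow> (int \<Rightarrow> real) measure" where
  "path_law M X = distr M (Pi\<^sub>M UNIV (\<lambda>_. borel)) (\<lambda>x t. X t x)"

definition strictly_stationary :: "'a measure \<Rightarrow> (int \<Rightarrow> 'a \<Rightarrow> real) \<Rightarrow> bool" where
  "strictly_stationary M X \<longleftrightarrow>
     (\<forall>t. X t \<in> borel_measurable M) \<and>
     (\<forall>h. path_law M (\<lambda>t. X (t + h)) = path_law M X)"

text \<open>Ergodicity of a stationary process: every shift-invariant event of the path space has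
  probability \<open>0\<close> or \<open>1\<close>.\<close>

definition ergodic_process :: "'a measure \<Rightarrow> (int \<Rightarrow> 'a \<Rightarrow> real) \<Rightarrow> bool" where
  "ergodic_process M X \<longleftrightarrow>
     strictly_stationary M X \<and>
     (\<forall>A\<in>sets (Pi\<^sub>M UNIV (\<lambda>_. borel)).
        (\<lambda>y t. y (t + 1)) -` A = A \<longrightarrow> measure (path_law M X) A \<in> {0, 1})"

definition non_anticipative ::
  "'a measure \<Rightarrow> (int \<Rightarrow> 'a \<Rightarrow> real) \<Rightarrow> (int \<Rightarrow> 'a \<Rightarrow> real) \<Rightarrow> bool" where
  "non_anticipative M \<eta> X \<longleftrightarrow>
     (\<forall>t. X t \<in> borel_measurable (SUP u\<in>{..t}. vimage_algebra (space M) (\<eta> u) borel))"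

end

theory Submission
  imports Defs
begin

text \<open>With \<open>z\<^sub>t\<close> the vector of the lagged values of \<open>1\<^bsub>\<epsilon>>0\<^esub> log \<epsilon>\<^sup>2\<close>, \<open>1\<^bsub>\<epsilon><0\<^esub> log \<epsilon>\<^sup>2\<close> and \<open>log \<sigma>\<^sup>2\<close>, the
  model is the affine recursion \<open>z\<^sub>t = C\<^sub>t z\<^sub>t\<^sub>-\<^sub>1 + b\<^sub>t\<close>, and the stationary solution is
  \<open>z\<^sub>t = \<Sum>\<^sub>k C\<^sub>t \<cdots> C\<^sub>t\<^sub>-\<^sub>k\<^sub>+\<^sub>1 b\<^sub>t\<^sub>-\<^sub>k\<close>. A negative Lyapunov exponent gives a block length \<open>l\<close> with
  \<open>E log \<parallel>C\<^sub>l \<cdots> C\<^sub>1\<parallel> < 0\<close>, hence \<open>E \<parallel>C\<^sub>l \<cdots> C\<^sub>1\<parallel>\<^sup>s < 1\<close> for some small \<open>s > 0\<close>; as disjoint blocks are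
  independent, the products decay geometrically almost surely, and neither Kingman's theorem nor a
  law of large numbers is needed. By the Borel-Cantelli lemma and the \<open>log\<^sup>+\<close> moment, \<open>b\<^sub>t\<^sub>-\<^sub>k\<close> grows
  subexponentially, so that the series converges. The solution is a shift equivariant function of
  the iid noise and inherits stationarity and ergodicity from the mixing of the Bernoulli shift.\<close>

section \<open>Matrices\<close>

text \<open>Carries decay of norms of products over to their single entries, in which the
  convergence of the series is later argued.\<close>

lemma matrix_norm_entry_bound:
  assumes "matrix_norm n N"
  shows "\<exists>c>0. \<forall>A\<in>carrier_mat n n. \<forall>i<n. \<forall>j<n. \<bar>A $$ (i, j)\<bar> \<le> c * N A"
proof -
  define E :: "nat \<Rightarrow> nat \<Rightarrow> real mat"
    where "E = (\<lambda>i j. mat n n (\<lambda>(a, b). of_bool (a = i \<and> b = j)))"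
  have E: "E i j \<in> carrier_mat n n" for i j
    by (simp add: E_def)
  have nonneg: "N A \<ge> 0" if "A \<in> carrier_mat n n" for A
    using assms that by (simp add: matrix_norm_def)
  have pos: "N (E i j) > 0" if "i < n" "j < n" for i j
  proof -
    have "E i j $$ (i, j) \<noteq> 0\<^sub>m n n $$ (i, j)"
      using that by (simp add: E_def)
    then have "N (E i j) \<noteq> 0"
      using assms E by (auto simp: matrix_norm_def)
    then show ?thesis
      using nonneg[OF E] by (simp add: order_less_le)
  qed
  have mult: "N (A * B) \<le> N A * N B" if "A \<in> carrier_mat n n" "B \<in> carrier_mat n n" for A B
    using assms that by (simp add: matrix_norm_def)
  have smult: "N (c \<cdot>\<^sub>m A) = \<bar>c\<bar> * N A" if "A \<in> carrier_mat n n" for A c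
    using assms that by (simp add: matrix_norm_def)
  text \<open>\<open>E\<^sub>i\<^sub>i A E\<^sub>j\<^sub>j = A\<^sub>i\<^sub>j E\<^sub>i\<^sub>j\<close>, so no equivalence of norms is needed.\<close>
  define K where "K i j = N (E i i) * N (E j j) / N (E i j)" for i j
  have K: "\<bar>A $$ (i, j)\<bar> \<le> K i j * N A" if A: "A \<in> carrier_mat n n" and ij: "i < n" "j < n" for A i j
  proof -
    have sum1: "(\<Sum>l = 0..<n. (if l = k then f l else 0)) = f k" if "k < n" for k and f :: "nat \<Rightarrow> real"
      using that by simp
    have "E i i * A = mat n n (\<lambda>(a, b). if a = i then A $$ (i, b) else 0)"
    proof (rule eq_matI)
      fix a b assume *: "a < dim_row (mat n n (\<lambda>(a, b). if a = i then A $$ (i, b) else 0))"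
        "b < dim_col (mat n n (\<lambda>(a, b). if a = i then A $$ (i, b) else 0))"
      have "(E i i * A) $$ (a, b) = (\<Sum>l = 0..<n. of_bool (a = i \<and> l = i) * A $$ (l, b))"
        using A * by (simp add: scalar_prod_def E_def)
      also have "\<dots> = (\<Sum>l = 0..<n. if l = i then of_bool (a = i) * A $$ (l, b) else 0)"
        by (intro sum.cong) auto
      also have "\<dots> = of_bool (a = i) * A $$ (i, b)"
        using sum1[OF ij(1)] .
      finally show "(E i i * A) $$ (a, b) = mat n n (\<lambda>(a, b). if a = i then A $$ (i, b) else 0) $$ (a, b)"
        using * by simp
    qed (use A in \<open>auto simp: E_def\<close>)
    then have "E i i * A * E j j = A $$ (i, j) \<cdot>\<^sub>m E i j"
    proof (intro eq_matI)
      fix a b assume EA: "E i i * A = mat n n (\<lambda>(a, b). if a = i then A $$ (i, b) else 0)"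
        and *: "a < dim_row (A $$ (i, j) \<cdot>\<^sub>m E i j)" "b < dim_col (A $$ (i, j) \<cdot>\<^sub>m E i j)"
      have "(E i i * A * E j j) $$ (a, b)
          = (\<Sum>l = 0..<n. (if a = i then A $$ (i, l) else 0) * of_bool (l = j \<and> b = j))"
        unfolding EA using * by (simp add: scalar_prod_def E_def)
      also have "\<dots> = (\<Sum>l = 0..<n. if l = j then (if a = i then A $$ (i, l) else 0) * of_bool (b = j) else 0)"
        by (intro sum.cong) auto
      also have "\<dots> = (if a = i then A $$ (i, j) else 0) * of_bool (b = j)"
        using sum1[OF ij(2)] .
      finally show "(E i i * A * E j j) $$ (a, b) = (A $$ (i, j) \<cdot>\<^sub>m E i j) $$ (a, b)"
        using * by (simp add: E_def)
    qed (use A in \<open>auto simp: E_def\<close>)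
    then have "\<bar>A $$ (i, j)\<bar> * N (E i j) = N (E i i * A * E j j)"
      using smult[OF E] by simp
    also have "\<dots> \<le> N (E i i * A) * N (E j j)"
      using mult[OF mult_carrier_mat[OF E A] E] .
    also have "\<dots> \<le> (N (E i i) * N A) * N (E j j)"
      using mult[OF E A] nonneg[OF E] by (intro mult_right_mono) auto
    finally show ?thesis
      using pos[OF ij] by (simp add: K_def field_simps)
  qed
  \<comment> \<open>The summand 1 keeps \<open>c\<close> positive also for
    \<open>n = 0\<close>.\<close>
  define c where "c = 1 + (\<Sum>i<n. \<Sum>j<n. K i j)"
  have K_nonneg: "K i j \<ge> 0" for i j
    using nonneg[OF E] by (simp add: K_def)
  have "K i j \<le> c" if "i < n" "j < n" for i j
  proof -
    have "K i j \<le> (\<Sum>j<n. K i j)"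
      using that K_nonneg by (intro member_le_sum) auto
    also have "\<dots> \<le> (\<Sum>i<n. \<Sum>j<n. K i j)"
      using that K_nonneg by (intro member_le_sum[where f = "\<lambda>i. \<Sum>j<n. K i j"]) (auto intro: sum_nonneg)
    finally show ?thesis by (simp add: c_def)
  qed
  then have "\<bar>A $$ (i, j)\<bar> \<le> c * N A" if "A \<in> carrier_mat n n" "i < n" "j < n" for A i j
    using K[OF that] nonneg[OF that(1)] that by (meson mult_right_mono order_trans)
  moreover have "c > 0"
    using K_nonneg by (auto simp: c_def intro!: add_pos_nonneg sum_nonneg)
  ultimately show ?thesis by blast
qed

text \<open>Vectors are plain functions of which only the values below \<open>n\<close> count, so
  that series, limits and measurability can be treated one component at a time.\<close>

definition mat_apply :: "nat \<Rightarrow> real mat \<Rightarrow> (nat \<Rightarrow> real) \<Rightarrow> nat \<Rightarrow> real" where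
  "mat_apply n A v i = (\<Sum>j<n. A $$ (i, j) * v j)"

lemma mat_apply_one: "i < n \<Longrightarrow> mat_apply n (1\<^sub>m n) v i = v i"
proof -
  assume i: "i < n"
  then have "mat_apply n (1\<^sub>m n) v i = (\<Sum>j<n. if j = i then v j else 0)"
    unfolding mat_apply_def by (intro sum.cong) auto
  with i show ?thesis by simp
qed

lemma mat_apply_mult:
  assumes "A \<in> carrier_mat n n" "B \<in> carrier_mat n n" "i < n"
  shows "mat_apply n (A * B) v i = mat_apply n A (mat_apply n B v) i"
proof -
  have "mat_apply n (A * B) v i = (\<Sum>j<n. \<Sum>l<n. A $$ (i, l) * B $$ (l, j) * v j)"
    using assms by (simp add: mat_apply_def scalar_prod_def sum_distrib_right atLeast0LessThan)
  also have "\<dots> = mat_apply n A (mat_apply n B v) i"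
    by (subst sum.swap) (simp add: mat_apply_def sum_distrib_left mult_ac)
  finally show ?thesis .
qed

lemma mat_apply_cong: "(\<And>j. j < n \<Longrightarrow> v j = w j) \<Longrightarrow> mat_apply n A v = mat_apply n A w"
  by (auto simp: mat_apply_def fun_eq_iff intro!: sum.cong)

lemma mat_apply_diff: "mat_apply n A (\<lambda>j. v j - w j) i = mat_apply n A v i - mat_apply n A w i"
  by (simp add: mat_apply_def right_diff_distrib sum_subtractf)

lemma abs_mat_apply_le:
  assumes "\<And>j. j < n \<Longrightarrow> \<bar>A $$ (i, j)\<bar> \<le> a" "\<And>j. j < n \<Longrightarrow> \<bar>v j\<bar> \<le> b"
  shows "\<bar>mat_apply n A v i\<bar> \<le> real n * (a * b)"
proof -
  have "\<bar>mat_apply n A v i\<bar> \<le> (\<Sum>j<n. \<bar>A $$ (i, j)\<bar> * \<bar>v j\<bar>)"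
    unfolding mat_apply_def by (rule order_trans[OF sum_abs]) (simp add: abs_mult)
  also have "\<dots> \<le> (\<Sum>j<n. a * b)"
  proof (intro sum_mono mult_mono)
    fix j assume "j \<in> {..<n}"
    then show "0 \<le> a" using assms(1)[of j] by auto
  qed (use assms in auto)
  finally show ?thesis by simp
qed

section \<open>Moments and almost sure growth\<close>

text \<open>\<open>log X\<close> may be \<open>-\<infinity>\<close> or have mean \<open>-\<infinity>\<close>; truncating it from below keeps the mean negative
  and makes Hoeffding's lemma applicable.\<close>

lemma (in prob_space) powr_moment_less_one:
  fixes X :: "'a \<Rightarrow> real"
  assumes X [measurable]: "X \<in> borel_measurable M"
    and bounds: "\<And>x. 0 \<le> X x" "\<And>x. X x \<le> B"
    and neg: "ereal_expectation M (\<lambda>x. ereal_log (ereal (X x))) < 0"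
  shows "\<exists>s>0. \<exists>\<rho>. 0 < \<rho> \<and> \<rho> < 1 \<and> (\<integral>\<^sup>+ x. ennreal (X x powr s) \<partial>M) \<le> ennreal \<rho>"
proof -
  define f g where "f x = e2ennreal (ereal_log (ereal (X x)))"
    and "g x = e2ennreal (- ereal_log (ereal (X x)))" for x
  \<comment> \<open>Real-valued positive part of the logarithm and negative part cut off at
    \<open>k\<close>. The case \<open>X x = 0\<close> stands apart because \<open>ln 0 = 0\<close>
    would hide the value \<open>-\<infinity>\<close>; there \<open>g'\<close> gets the full
    cut-off.\<close>
  define f' where "f' x = (if X x = 0 then 0 else max 0 (ln (X x)))" for x
  define g' where "g' k x = (if X x = 0 then k else min (max 0 (- ln (X x))) k)" for x and k :: real
  have [measurable]: "f' \<in> borel_measurable M" "g' k \<in> borel_measurable M" for k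
    unfolding f'_def[abs_def] g'_def[abs_def] by measurable
  have f: "f x = ennreal (f' x)" for x
    using bounds(1)[of x]
    by (auto simp: f_def f'_def ereal_log_def e2ennreal_neg max_def ennreal_neg)
  have g_eq: "g x = (if X x = 0 then \<infinity> else ennreal (- ln (X x)))" for x
    using bounds(1)[of x] by (auto simp: g_def ereal_log_def)
  have g: "min (g x) (of_nat k) = ennreal (g' (real k) x)" for k x
    by (auto simp: g_eq g'_def top_unique ennreal_of_nat_eq_real_of_nat min_def max_def ennreal_neg ennreal_le_iff2)
  have [measurable]: "g \<in> borel_measurable M"
    unfolding g_eq[abs_def] by measurable
  \<comment> \<open>In \<open>ereal\<close> the difference of two infinities is
    \<open>\<infinity>\<close>, so a negative expectation rules out that case as well.\<close>
  have less: "(\<integral>\<^sup>+ x. f x \<partial>M) < (\<integral>\<^sup>+ x. g x \<partial>M)"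
  proof (rule ccontr)
    assume "\<not> ?thesis"
    then have "enn2ereal (\<integral>\<^sup>+ x. g x \<partial>M) \<le> enn2ereal (\<integral>\<^sup>+ x. f x \<partial>M)"
      by (simp add: less_eq_ennreal.rep_eq[symmetric])
    then have "0 \<le> ereal_expectation M (\<lambda>x. ereal_log (ereal (X x)))"
      unfolding ereal_expectation_def f_def[symmetric] g_def[symmetric]
      by (cases "enn2ereal (\<integral>\<^sup>+ x. g x \<partial>M)"; cases "enn2ereal (\<integral>\<^sup>+ x. f x \<partial>M)") auto
    with neg show False by simp
  qed
  \<comment> \<open>Monotone convergence: some finite cut-off of the negative part already outweighs
    the positive part.\<close>
  have "(SUP k. min (g x) (of_nat k)) = g x" for x
    using inf_SUP[of "g x" "of_nat :: nat \<Rightarrow> ennreal" UNIV]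
    by (simp add: inf_min[symmetric] ennreal_SUP_of_nat_eq_top)
  then have "(\<integral>\<^sup>+ x. g x \<partial>M) = (SUP k. \<integral>\<^sup>+ x. min (g x) (of_nat k) \<partial>M)"
    by (subst nn_integral_monotone_convergence_SUP[symmetric])
      (auto simp: incseq_def le_fun_def intro: min.coboundedI2)
  with less obtain k :: nat where k: "(\<integral>\<^sup>+ x. f x \<partial>M) < (\<integral>\<^sup>+ x. min (g x) (of_nat k) \<partial>M)"
    by (auto simp: less_SUP_iff)
  have f'b: "0 \<le> f' x" "f' x \<le> \<bar>B\<bar>" for x
  proof -
    show "0 \<le> f' x" by (simp add: f'_def)
    have "ln (X x) \<le> \<bar>B\<bar>" if "X x \<noteq> 0"
      using bounds[of x] that ln_le_minus_one[of "X x"] by auto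
    then show "f' x \<le> \<bar>B\<bar>" by (simp add: f'_def)
  qed
  have g'b: "0 \<le> g' (real k) x" "g' (real k) x \<le> real k" for x
    by (auto simp: g'_def)
  have int: "integrable M f'" "integrable M (g' (real k))"
    by (rule integrable_const_bound[where B = "\<bar>B\<bar>"], use f'b in simp_all)
      (rule integrable_const_bound[where B = "real k"], use g'b in simp_all)
  define L where "L x = f' x - g' (real k) x" for x
  have "ennreal (expectation f') < ennreal (expectation (g' (real k)))"
    using k f'b g'b int by (simp add: f g nn_integral_eq_integral)
  then have "expectation f' < expectation (g' (real k))"
    using f'b by (simp add: ennreal_less_iff integral_nonneg_AE)
  then have EL: "expectation L < 0"
    unfolding L_def using int by simp
  define w where "w = \<bar>B\<bar> + real k + 1"
  have w: "w > 0" by (simp add: w_def add_nonneg_pos)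
  interpret interval_bounded_random_variable M L "- real k" "\<bar>B\<bar> + 1"
  proof
    show "random_variable borel L" unfolding L_def by measurable
    have "- real k \<le> L x \<and> L x \<le> \<bar>B\<bar> + 1" for x
      using f'b[of x] g'b[of x] by (simp add: L_def)
    then show "AE x in M. L x \<in> {- real k..\<bar>B\<bar> + 1}"
      by simp
  qed
  define \<mu> where "\<mu> = expectation L"
  \<comment> \<open>This \<open>s\<close> minimises the exponent
    \<open>s * \<mu> + s^2 * w^2 / 8\<close> of Hoeffding's bound, whose minimum is the exponent in
    \<open>\<rho>\<close>. The extra 1 in \<open>w\<close> keeps the divisor positive.\<close>
  define s where "s = - 4 * \<mu> / w\<^sup>2"
  define \<rho> where "\<rho> = exp (- 2 * \<mu>\<^sup>2 / w\<^sup>2)"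
  have s: "s > 0"
    using EL w by (simp add: s_def \<mu>_def divide_less_0_iff)
  have "X x powr s \<le> exp (s * \<mu>) * exp (s * (L x - \<mu>))" for x
  proof (cases "X x = 0")
    case False
    then have "ln (X x) \<le> L x"
      by (auto simp: L_def f'_def g'_def)
    then have "s * ln (X x) \<le> s * L x"
      using s by simp
    then show ?thesis
      using False by (simp add: powr_def exp_add[symmetric] right_diff_distrib)
  qed simp
  then have "(\<integral>\<^sup>+ x. ennreal (X x powr s) \<partial>M)
      \<le> (\<integral>\<^sup>+ x. ennreal (exp (s * \<mu>)) * ennreal (exp (s * (L x - \<mu>))) \<partial>M)"
    by (intro nn_integral_mono) (simp add: ennreal_mult[symmetric])
  also have "\<dots> = ennreal (exp (s * \<mu>)) * (\<integral>\<^sup>+ x. ennreal (exp (s * (L x - \<mu>))) \<partial>M)"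
    by (intro nn_integral_cmult) (simp add: L_def)
  also have "\<dots> \<le> ennreal (exp (s * \<mu>)) * ennreal (exp (s\<^sup>2 * w\<^sup>2 / 8))"
    using Hoeffdings_lemma_nn_integral[OF s]
    by (intro mult_left_mono) (simp_all add: \<mu>_def w_def algebra_simps)
  also have "\<dots> = ennreal \<rho>"
    using w by (simp add: ennreal_mult[symmetric] exp_add[symmetric] \<rho>_def s_def power2_eq_square field_simps)
  finally have "(\<integral>\<^sup>+ x. ennreal (X x powr s) \<partial>M) \<le> ennreal \<rho>" .
  moreover have "\<rho> < 1" "0 < \<rho>"
    using EL w by (simp_all add: \<rho>_def \<mu>_def divide_neg_pos)
  ultimately show ?thesis using s by blast
qed

text \<open>By independence the s-th power of the product has mean at most
  \<open>\<rho> ^ m\<close>. Divided by \<open>\<rho>' ^ m\<close> with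
  \<open>\<rho> < \<rho>' < 1\<close>, these means are summable, so almost surely the series of the
  quotients converges and its terms are bounded. Taking the power \<open>1 / s\<close> gives the
  rate \<open>r\<close>; only \<open>K\<close> depends on the sample point.\<close>

lemma (in prob_space) AE_prod_geometric_decay:
  fixes X :: "nat \<Rightarrow> 'a \<Rightarrow> real"
  assumes indep: "indep_vars (\<lambda>_. borel) X UNIV" and nonneg: "\<And>j x. 0 \<le> X j x"
    and s: "s > 0" and \<rho>: "0 < \<rho>" "\<rho> < 1"
    and moment: "\<And>j. (\<integral>\<^sup>+ x. ennreal (X j x powr s) \<partial>M) \<le> ennreal \<rho>"
  shows "\<exists>r. 0 < r \<and> r < 1 \<and> (AE x in M. \<exists>K. \<forall>m. (\<Prod>j<m. X j x) \<le> K * r ^ m)"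
proof -
  have [measurable]: "X j \<in> borel_measurable M" for j
    using indep by (auto simp: indep_vars_def)
  define \<rho>' where "\<rho>' = (1 + \<rho>) / 2"
  have \<rho>': "0 < \<rho>'" "\<rho>' < 1" "\<rho> < \<rho>'"
    using \<rho> by (auto simp: \<rho>'_def)
  define r where "r = \<rho>' powr (1 / s)"
  define Z where "Z m x = (\<Prod>j<m. X j x powr s)" for m x
  have [measurable]: "Z m \<in> borel_measurable M" for m
    unfolding Z_def by measurable
  have Z_nonneg: "0 \<le> Z m x" for m x
    by (simp add: Z_def prod_nonneg)
  have EZ: "(\<integral>\<^sup>+ x. ennreal (Z m x / \<rho>' ^ m) \<partial>M) \<le> ennreal ((\<rho> / \<rho>') ^ m)" for m
  proof -
    have ind: "indep_vars (\<lambda>_. borel) (\<lambda>j x. ennreal (X j x powr s)) {..<m}"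
      by (rule indep_vars_compose2[OF indep_vars_subset[OF indep]]) auto
    have "(\<integral>\<^sup>+ x. ennreal (Z m x / \<rho>' ^ m) \<partial>M)
        = (\<integral>\<^sup>+ x. ennreal (1 / \<rho>' ^ m) * (\<Prod>j<m. ennreal (X j x powr s)) \<partial>M)"
      using \<rho>' by (intro nn_integral_cong) (simp add: prod_ennreal Z_def ennreal_mult[symmetric] prod_nonneg)
    also have "\<dots> = ennreal (1 / \<rho>' ^ m) * (\<integral>\<^sup>+ x. (\<Prod>j<m. ennreal (X j x powr s)) \<partial>M)"
      by (intro nn_integral_cmult) measurable
    also have "\<dots> = ennreal (1 / \<rho>' ^ m) * (\<Prod>j<m. \<integral>\<^sup>+ x. ennreal (X j x powr s) \<partial>M)"
      by (subst indep_vars_nn_integral[OF _ ind]) auto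
    also have "\<dots> \<le> ennreal (1 / \<rho>' ^ m) * (\<Prod>j<m. ennreal \<rho>)"
      by (intro mult_left_mono prod_mono_ennreal moment) auto
    also have "\<dots> = ennreal ((\<rho> / \<rho>') ^ m)"
      using \<rho> \<rho>' by (simp add: ennreal_power ennreal_mult[symmetric] power_divide)
    finally show ?thesis .
  qed
  have "(\<integral>\<^sup>+ x. (\<Sum>m. ennreal (Z m x / \<rho>' ^ m)) \<partial>M) = (\<Sum>m. \<integral>\<^sup>+ x. ennreal (Z m x / \<rho>' ^ m) \<partial>M)"
    by (intro nn_integral_suminf) measurable
  also have "\<dots> \<le> (\<Sum>m. ennreal ((\<rho> / \<rho>') ^ m))"
    by (intro suminf_le EZ) auto
  also have "\<dots> < \<infinity>"
    using \<rho> \<rho>' by (subst suminf_ennreal2) (auto intro!: summable_geometric)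
  finally have "AE x in M. (\<Sum>m. ennreal (Z m x / \<rho>' ^ m)) \<noteq> \<infinity>"
    by (intro nn_integral_PInf_AE) auto
  moreover have "\<exists>K. \<forall>m. (\<Prod>j<m. X j x) \<le> K * r ^ m" if fin: "(\<Sum>m. ennreal (Z m x / \<rho>' ^ m)) \<noteq> \<infinity>" for x
  proof -
    obtain K where K: "0 \<le> K" "(\<Sum>m. ennreal (Z m x / \<rho>' ^ m)) = ennreal K"
      using fin by (cases "\<Sum>m. ennreal (Z m x / \<rho>' ^ m)" rule: ennreal_cases) auto
    have "(\<Prod>j<m. X j x) \<le> K powr (1 / s) * r ^ m" for m
    proof -
      have "ennreal (Z m x / \<rho>' ^ m) \<le> ennreal K"
        unfolding K(2)[symmetric] using sum_le_suminf[of "\<lambda>m. ennreal (Z m x / \<rho>' ^ m)" "{m}"] by simp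
      then have "Z m x \<le> K * \<rho>' ^ m"
        using K(1) \<rho>' by (simp add: pos_divide_le_eq)
      then have "Z m x powr (1 / s) \<le> (K * \<rho>' ^ m) powr (1 / s)"
        using Z_nonneg s by (intro powr_mono2) auto
      also have "\<dots> = K powr (1 / s) * r ^ m"
        using K(1) \<rho>' by (simp add: powr_mult r_def powr_power powr_powr powr_realpow[symmetric] mult.commute)
      also have "Z m x powr (1 / s) = (\<Prod>j<m. X j x)"
        using s nonneg by (simp add: Z_def prod_powr_distrib powr_powr)
      finally show ?thesis .
    qed
    then show ?thesis by blast
  qed
  ultimately have "AE x in M. \<exists>K. \<forall>m. (\<Prod>j<m. X j x) \<le> K * r ^ m"
    by (auto elim: eventually_mono)
  moreover have "0 < r" "r < 1"
    using \<rho>' s powr_less_mono2[of "1 / s" \<rho>' 1] by (simp_all add: r_def)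
  ultimately show ?thesis by blast
qed

text \<open>Pathwise form of the tail bound
  \<open>\<Sum> P(Y > \<delta> k) \<le> E Y / \<delta>\<close>, which follows by integrating over
  \<open>y\<close>.\<close>

lemma sum_of_bool_multiples_less_le:
  fixes y \<delta> :: real
  assumes "0 \<le> y" "0 < \<delta>"
  shows "(\<Sum>k<n. of_bool (\<delta> * real (Suc k) < y)) \<le> y / \<delta>"
proof -
  define S where "S n = (\<Sum>k<n. of_bool (\<delta> * real (Suc k) < y) :: real)" for n
  \<comment> \<open>The second bound closes the induction: if the new multiple lies below
    \<open>y\<close>, then already \<open>real (Suc n) < y / \<delta>\<close>.\<close>
  have "S n \<le> y / \<delta> \<and> S n \<le> real n"
  proof (induction n)
    case 0
    then show ?case using assms by (simp add: S_def)
  next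
    case (Suc n)
    have S: "S (Suc n) = S n + of_bool (\<delta> * real (Suc n) < y)"
      by (simp add: S_def)
    have "real (Suc n) < y / \<delta>" if "\<delta> * real (Suc n) < y"
      using that assms by (simp add: field_simps)
    then show ?case
      unfolding S using Suc by (cases "\<delta> * real (Suc n) < y") auto
  qed
  then show ?thesis by (simp add: S_def)
qed

text \<open>Equal laws turn the sum of the probabilities of \<open>Y k > \<delta> k\<close> into a
  tail sum of \<open>Y 0\<close>, at most \<open>E (Y 0) / \<delta>\<close>. By Borel-Cantelli only
  finitely many exceedances remain.\<close>

lemma (in prob_space) AE_identically_distributed_sublinear:
  fixes Y :: "nat \<Rightarrow> 'a \<Rightarrow> real"
  assumes Y [measurable]: "\<And>k. Y k \<in> borel_measurable M"
    and ident: "\<And>k. distr M borel (Y k) = distr M borel (Y 0)"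
    and nonneg: "\<And>k x. 0 \<le> Y k x" and fin: "(\<integral>\<^sup>+ x. ennreal (Y 0 x) \<partial>M) < \<infinity>" and \<delta>: "\<delta> > 0"
  shows "AE x in M. \<exists>K. \<forall>k. Y k x \<le> K + \<delta> * real k"
proof -
  \<comment> \<open>Index 0 is left out: its threshold would be 0 and exceed the count of positive
    multiples.\<close>
  define A where "A k = {x \<in> space M. \<delta> * real (Suc k) < Y (Suc k) x}" for k
  have [measurable]: "A k \<in> sets M" for k
    unfolding A_def by measurable
  have A: "emeasure M (A k) = (\<integral>\<^sup>+ x. ennreal (of_bool (\<delta> * real (Suc k) < Y 0 x)) \<partial>M)" for k
  proof -
    have *: "emeasure M {x \<in> space M. \<delta> * real (Suc k) < Y j x}
        = emeasure (distr M borel (Y j)) {\<delta> * real (Suc k)<..}" for j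
      by (subst emeasure_distr) (auto intro!: arg_cong[where f = "emeasure M"])
    have "emeasure M (A k) = emeasure M {x \<in> space M. \<delta> * real (Suc k) < Y 0 x}"
      unfolding A_def * ident[of "Suc k"] ..
    also have "\<dots> = (\<integral>\<^sup>+ x. indicator {x \<in> space M. \<delta> * real (Suc k) < Y 0 x} x \<partial>M)"
      by (intro nn_integral_indicator[symmetric]) measurable
    also have "\<dots> = (\<integral>\<^sup>+ x. ennreal (of_bool (\<delta> * real (Suc k) < Y 0 x)) \<partial>M)"
      by (intro nn_integral_cong) (simp add: indicator_def)
    finally show ?thesis .
  qed
  have "(\<Sum>k. ennreal (of_bool (\<delta> * real (Suc k) < Y 0 x))) \<le> ennreal (1 / \<delta>) * ennreal (Y 0 x)" for x
  proof (rule suminf_le_const)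
    fix n
    have "(\<Sum>k<n. ennreal (of_bool (\<delta> * real (Suc k) < Y 0 x)))
        = ennreal (\<Sum>k<n. of_bool (\<delta> * real (Suc k) < Y 0 x))"
      by (intro sum_ennreal) auto
    also have "\<dots> \<le> ennreal (Y 0 x / \<delta>)"
      by (intro ennreal_leI sum_of_bool_multiples_less_le nonneg \<delta>)
    also have "\<dots> = ennreal (1 / \<delta>) * ennreal (Y 0 x)"
      using \<delta> nonneg by (simp add: ennreal_mult[symmetric])
    finally show "(\<Sum>k<n. ennreal (of_bool (\<delta> * real (Suc k) < Y 0 x))) \<le> ennreal (1 / \<delta>) * ennreal (Y 0 x)" .
  qed simp
  then have "(\<integral>\<^sup>+ x. (\<Sum>k. ennreal (of_bool (\<delta> * real (Suc k) < Y 0 x))) \<partial>M)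
      \<le> (\<integral>\<^sup>+ x. ennreal (1 / \<delta>) * ennreal (Y 0 x) \<partial>M)"
    by (intro nn_integral_mono)
  also have "\<dots> = ennreal (1 / \<delta>) * (\<integral>\<^sup>+ x. ennreal (Y 0 x) \<partial>M)"
    by (intro nn_integral_cmult) measurable
  also have "\<dots> < \<infinity>"
    using fin by (simp add: ennreal_mult_less_top)
  also have "(\<integral>\<^sup>+ x. (\<Sum>k. ennreal (of_bool (\<delta> * real (Suc k) < Y 0 x))) \<partial>M) = (\<Sum>k. emeasure M (A k))"
    unfolding A by (intro nn_integral_suminf) measurable
  finally have "summable (\<lambda>k. measure M (A k))"
    by (intro summable_suminf_not_top) (auto simp: emeasure_eq_measure)
  then have "AE x in M. eventually (\<lambda>k. x \<in> space M - A k) sequentially"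
    by (intro borel_cantelli_AE1) (auto simp: emeasure_eq_measure)
  then show ?thesis
  proof eventually_elim
    case (elim x)
    then obtain n where n: "\<And>k. k \<ge> n \<Longrightarrow> Y (Suc k) x \<le> \<delta> * real (Suc k)"
      by (auto simp: eventually_sequentially A_def not_less)
    \<comment> \<open>The sum dominates each of the finitely many values that may exceed the
      line.\<close>
    define K where "K = (\<Sum>k\<le>n. Y k x)"
    have "Y k x \<le> K + \<delta> * real k" for k
    proof (cases "k \<le> n")
      case True
      then have "Y k x \<le> K"
        unfolding K_def using nonneg by (intro member_le_sum) auto
      moreover have "0 \<le> \<delta> * real k"
        using \<delta> by simp
      ultimately show ?thesis by linarith
    next
      case False
      then obtain j where "k = Suc j" "j \<ge> n"
        by (cases k) auto
      moreover have "0 \<le> K"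
        unfolding K_def using nonneg by (intro sum_nonneg) auto
      ultimately show ?thesis using n[of j] by simp
    qed
    then show ?case by blast
  qed
qed

text \<open>Tightness of a single real random variable, by continuity of the measure along sets that
  decrease to the empty set.\<close>

lemma (in prob_space) prob_abs_gt_tendsto_0:
  fixes U :: "'a \<Rightarrow> real"
  assumes [measurable]: "U \<in> borel_measurable M"
  shows "(\<lambda>n. prob {x \<in> space M. real n < \<bar>U x\<bar>}) \<longlonglongrightarrow> 0"
proof -
  have "(\<lambda>n. prob {x \<in> space M. real n < \<bar>U x\<bar>}) \<longlonglongrightarrow> prob (\<Inter>n. {x \<in> space M. real n < \<bar>U x\<bar>})"
    by (intro finite_Lim_measure_decseq) (auto simp: decseq_def)
  also have "(\<Inter>n. {x \<in> space M. real n < \<bar>U x\<bar>}) = {}"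
  proof -
    have "x \<notin> (\<Inter>n. {x \<in> space M. real n < \<bar>U x\<bar>})" for x
      using real_arch_simple[of "\<bar>U x\<bar>"] by (auto simp: not_less)
    then show ?thesis by blast
  qed
  finally show ?thesis by simp
qed

section \<open>Mixing of the Bernoulli shift\<close>

lemma distr_PiM_shift:
  fixes D :: "'b measure"
  assumes "prob_space D"
  shows "distr (Pi\<^sub>M UNIV (\<lambda>_::int. D)) (Pi\<^sub>M UNIV (\<lambda>_. D)) (\<lambda>y t. y (t + h)) = Pi\<^sub>M UNIV (\<lambda>_. D)"
  using distr_PiM_reindex[of "UNIV :: int set" "\<lambda>_. D" "\<lambda>t. t + h" UNIV] assms
  by (simp add: restrict_UNIV inj_on_def)

text \<open>Independence makes the law of the path a product measure, and with equal factors the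
  shift by \<open>h\<close> is a mere reindexing.\<close>

lemma iid_path_distr:
  fixes \<eta> :: "int \<Rightarrow> 'a \<Rightarrow> real"
  assumes "prob_space M" and indep: "prob_space.indep_vars M (\<lambda>_. borel) \<eta> UNIV"
    and ident: "\<And>t. distr M borel (\<eta> t) = distr M borel (\<eta> 0)"
  shows "distr M (Pi\<^sub>M UNIV (\<lambda>_. borel)) (\<lambda>x t. \<eta> (t + h) x) = Pi\<^sub>M UNIV (\<lambda>_. distr M borel (\<eta> 0))"
proof -
  interpret prob_space M by fact
  have rv [measurable]: "random_variable borel (\<eta> t)" for t
    using indep by (auto simp: indep_vars_def)
  let ?D = "distr M borel (\<eta> 0)"
  have "distr M (Pi\<^sub>M UNIV (\<lambda>_. borel)) (\<lambda>x. \<lambda>t\<in>UNIV. \<eta> t x) = Pi\<^sub>M UNIV (\<lambda>t. distr M borel (\<eta> t))"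
    using indep by (subst (asm) indep_vars_iff_distr_eq_PiM) (auto intro: rv)
  also have "\<dots> = Pi\<^sub>M UNIV (\<lambda>_. ?D)"
    by (intro PiM_cong refl ident)
  finally have law: "distr M (Pi\<^sub>M UNIV (\<lambda>_. borel)) (\<lambda>x t. \<eta> t x) = Pi\<^sub>M UNIV (\<lambda>_. ?D)"
    by (simp add: restrict_UNIV)
  have sets: "sets (Pi\<^sub>M UNIV (\<lambda>_::int. ?D)) = sets (Pi\<^sub>M UNIV (\<lambda>_::int. borel))"
    by (rule sets_PiM_cong) simp_all
  have path: "(\<lambda>x t. \<eta> t x) \<in> measurable M (Pi\<^sub>M UNIV (\<lambda>_. borel))"
    by (rule measurable_PiM_single') (auto simp: space_PiM)
  have shift: "(\<lambda>y t. y (t + h)) \<in> measurable (Pi\<^sub>M UNIV (\<lambda>_::int. borel)) (Pi\<^sub>M UNIV (\<lambda>_::int. borel :: real measure))"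
    by (rule measurable_PiM_single') (auto simp: space_PiM)
  have "distr M (Pi\<^sub>M UNIV (\<lambda>_. borel)) (\<lambda>x t. \<eta> (t + h) x)
      = distr (distr M (Pi\<^sub>M UNIV (\<lambda>_. borel)) (\<lambda>x t. \<eta> t x)) (Pi\<^sub>M UNIV (\<lambda>_. borel)) (\<lambda>y t. y (t + h))"
    by (subst distr_distr[OF shift path]) (simp add: comp_def)
  also have "\<dots> = distr (Pi\<^sub>M UNIV (\<lambda>_. ?D)) (Pi\<^sub>M UNIV (\<lambda>_. ?D)) (\<lambda>y t. y (t + h))"
    unfolding law by (intro distr_cong sets[symmetric] refl)
  also have "\<dots> = Pi\<^sub>M UNIV (\<lambda>_. ?D)"
    by (intro distr_PiM_shift prob_space_distr rv)
  finally show ?thesis .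
qed

context prob_space
begin

text \<open>Tannery's theorem, dominated by the probabilities of the disjoint events
  \<open>D i\<close>, which do not vary with \<open>n\<close>. It provides the disjoint union step
  in both inductions for mixing.\<close>

lemma tendsto_prob_UN_disjoint:
  assumes C: "\<And>i n. C i n \<in> events" and D: "\<And>i. D i \<in> events"
    and disj: "\<And>n. disjoint_family (\<lambda>i. C i n)" "disjoint_family D"
    and le: "\<And>i n. prob (C i n) \<le> prob (D i)"
    and lim: "\<And>i. (\<lambda>n. prob (C i n)) \<longlonglongrightarrow> c i"
  shows "summable c" "(\<lambda>n. prob (\<Union>i. C i n)) \<longlonglongrightarrow> suminf c"
proof -
  have D': "(\<lambda>i. prob (D i)) sums prob (\<Union>i. D i)"
    using D disj(2) by (intro finite_measure_UNION) auto
  have bound: "eventually (\<lambda>(i, n). norm (prob (C i n)) \<le> prob (D i)) (at_top \<times>\<^sub>F sequentially)"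
    using le by (simp add: case_prod_unfold)
  note T = tannerys_theorem[OF lim bound sums_summable[OF D'] sequentially_bot]
  then show "summable c"
    using summable_norm_cancel by blast
  have "prob (\<Union>i. C i n) = (\<Sum>i. prob (C i n))" for n
    using C disj(1) finite_measure_UNION[of "\<lambda>i. C i n"] by (auto intro: sums_unique)
  then show "(\<lambda>n. prob (\<Union>i. C i n)) \<longlonglongrightarrow> suminf c"
    using T by simp
qed

text \<open>Mixing extends from a generator first in \<open>A\<close> and then in \<open>B\<close>.\<close>

lemma measure_preserving_mixing_induct:
  assumes G: "Int_stable G" "G \<subseteq> Pow (space M)" and sets: "events = sigma_sets (space M) G"
    and T: "\<And>n. T n \<in> measurable M M" "\<And>n. distr M M (T n) = M"
    and basic: "\<And>A B. A \<in> G \<Longrightarrow> B \<in> G \<Longrightarrow>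
      (\<lambda>n::nat. prob (A \<inter> (T n -` B \<inter> space M))) \<longlonglongrightarrow> prob A * prob B"
    and A: "A \<in> events" and B: "B \<in> events"
  shows "(\<lambda>n. prob (A \<inter> (T n -` B \<inter> space M))) \<longlonglongrightarrow> prob A * prob B"
proof -
  let ?T = "\<lambda>n B. T n -` B \<inter> space M"
  have TB: "?T n B \<in> events" if "B \<in> events" for n B
    using measurable_sets[OF T(1) that] .
  have prob_T: "prob (?T n B) = prob B" if "B \<in> events" for n B
    using measure_distr[OF T(1) that, of n] T(2)[of n] by simp
  have step: "(\<lambda>n. prob (A \<inter> ?T n B)) \<longlonglongrightarrow> prob A * prob B" if "A \<in> events" "B \<in> G" for A B
  proof -
    have B: "B \<in> events"
      using that sets by auto
    show ?thesis
      using G that(1)[unfolded sets]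
    proof (induction A rule: sigma_sets_induct_disjoint)
      case (compl A)
      then have A: "A \<in> events" by (simp add: sets)
      have eq: "prob ((space M - A) \<inter> ?T n B) = prob B - prob (A \<inter> ?T n B)" for n
      proof -
        have "(space M - A) \<inter> ?T n B = ?T n B - (A \<inter> ?T n B)"
          by auto
        then show ?thesis
          using finite_measure_Diff[OF TB[OF B] sets.Int[OF A TB[OF B]], of n n] prob_T[OF B, of n]
          by auto
      qed
      have "(\<lambda>n. prob ((space M - A) \<inter> ?T n B)) \<longlonglongrightarrow> prob B - prob A * prob B"
        unfolding eq by (intro tendsto_intros compl)
      then show ?case
        by (simp add: prob_compl[OF A] algebra_simps)
    next
      case (union F)
      then have F: "F i \<in> events" for i by (auto simp: sets)
      have FB: "F i \<inter> ?T n B \<in> events" for i n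
        using sets.Int[OF F TB[OF B]] .
      have disj: "disjoint_family (\<lambda>i. F i \<inter> ?T n B)" for n
        using union(1) unfolding disjoint_family_on_def by blast
      have "(\<lambda>n. prob (\<Union>i. F i \<inter> ?T n B)) \<longlonglongrightarrow> (\<Sum>i. prob (F i) * prob B)"
        by (rule tendsto_prob_UN_disjoint(2)[where D = F])
          (use F FB disj union in \<open>auto intro: finite_measure_mono\<close>)
      moreover have "(\<lambda>i. prob (F i) * prob B) sums (prob (\<Union>i. F i) * prob B)"
        using F union by (intro sums_mult2 finite_measure_UNION) auto
      ultimately show ?case
        by (simp add: sums_unique[symmetric])
    qed (use that basic in auto)
  qed
  show ?thesis
    using G B[unfolded sets]
  proof (induction B rule: sigma_sets_induct_disjoint)
    case (compl B)
    then have B: "B \<in> events" by (simp add: sets)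
    have eq: "prob (A \<inter> ?T n (space M - B)) = prob A - prob (A \<inter> ?T n B)" for n
    proof -
      have "A \<inter> ?T n (space M - B) = A - (A \<inter> ?T n B)"
        using measurable_space[OF T(1)] sets.sets_into_space[OF A] by auto
      then show ?thesis
        using finite_measure_Diff[OF A, of "A \<inter> ?T n B"] A TB[OF B] by (simp add: sets.Int)
    qed
    have "(\<lambda>n. prob (A \<inter> ?T n (space M - B))) \<longlonglongrightarrow> prob A - prob A * prob B"
      unfolding eq by (intro tendsto_intros compl)
    then show ?case
      by (simp add: prob_compl[OF B] algebra_simps)
  next
    case (union F)
    then have F: "F i \<in> events" for i by (auto simp: sets)
    have AF: "A \<inter> ?T n (F i) \<in> events" for i n
      using sets.Int[OF A TB[OF F]] .
    \<comment> \<open>Measure preservation supplies a dominating event that is independent of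
      \<open>n\<close>.\<close>
    have le: "prob (A \<inter> ?T n (F i)) \<le> prob (F i)" for i n
      using finite_measure_mono[OF Int_lower2 TB[OF F]] unfolding prob_T[OF F] .
    have disj: "disjoint_family (\<lambda>i. A \<inter> ?T n (F i))" for n
      using union(1) unfolding disjoint_family_on_def by blast
    have "(\<lambda>n. prob (\<Union>i. A \<inter> ?T n (F i))) \<longlonglongrightarrow> (\<Sum>i. prob A * prob (F i))"
      by (rule tendsto_prob_UN_disjoint(2)[where D = F])
        (use F AF le disj union in auto)
    moreover have "(\<lambda>i. prob A * prob (F i)) sums (prob A * prob (\<Union>i. F i))"
      using F union by (intro sums_mult finite_measure_UNION) auto
    moreover have "(\<Union>i. A \<inter> ?T n (F i)) = A \<inter> ?T n (\<Union>i. F i)" for n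
      by auto
    ultimately show ?case
      by (simp add: sums_unique[symmetric])
  qed (use A step in auto)
qed

end

text \<open>Two cylinders become exactly independent once the shift has moved their finite index
  sets apart, so the shift is mixing. For an invariant \<open>A\<close> mixing of \<open>A\<close>
  with itself reads \<open>P(A) = P(A) * P(A)\<close>.\<close>

lemma PiM_shift_invariant_0_1:
  fixes D :: "real measure"
  assumes D: "prob_space D" "sets D = sets borel"
    and A: "A \<in> sets (Pi\<^sub>M UNIV (\<lambda>_::int. D))"
    and inv: "(\<lambda>y t. y (t + 1)) -` A = A"
  shows "measure (Pi\<^sub>M UNIV (\<lambda>_. D)) A \<in> {0, 1}"
proof -
  interpret D: prob_space D by fact
  interpret product_prob_space "\<lambda>_. D" "UNIV :: int set" ..
  let ?P = "Pi\<^sub>M UNIV (\<lambda>_::int. D)"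
  interpret P: prob_space ?P
    by (rule prob_space_PiM) (rule D)
  have [simp]: "space D = UNIV"
    using sets_eq_imp_space_eq[OF D(2)] by simp
  have space: "space ?P = UNIV"
    by (simp add: space_PiM PiE_UNIV_domain)
  define T where "T n y t = y (t + int n)" for n :: nat and y :: "int \<Rightarrow> real" and t
  have T [measurable]: "T n \<in> measurable ?P ?P" for n
    unfolding T_def[abs_def] by (rule measurable_PiM_single') (auto simp: space)
  define cyl where "cyl J E = {y. \<forall>j\<in>J. y j \<in> E j}" for J :: "int set" and E :: "int \<Rightarrow> real set"
  have cyl: "emeasure ?P (cyl J E) = (\<Prod>j\<in>J. emeasure D (E j))" "cyl J E \<in> sets ?P"
    if "finite J" "\<And>j. j \<in> J \<Longrightarrow> E j \<in> sets D" for J E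
  proof -
    have *: "cyl J E = {y \<in> space ?P. \<forall>j\<in>J. y j \<in> E j}"
      by (simp add: cyl_def space)
    show "emeasure ?P (cyl J E) = (\<Prod>j\<in>J. emeasure D (E j))"
      unfolding * using that by (intro emeasure_PiM_Collect) auto
    show "cyl J E \<in> sets ?P"
      unfolding * using that by (intro sets.sets_Collect_finite_All) auto
  qed
  have emb: "prod_emb UNIV (\<lambda>_. D) J (Pi\<^sub>E J E) = cyl J E" for J E
    by (auto simp: prod_emb_def cyl_def PiE_UNIV_domain PiE_iff extensional_def)
  have Tcyl: "T n -` cyl J E = cyl ((\<lambda>j. j + int n) ` J) (\<lambda>j. E (j - int n))" for n J E
    by (auto simp: cyl_def T_def)
  have shift_prod: "(\<Prod>j\<in>(\<lambda>j. j + int n) ` J. emeasure D (E (j - int n))) = (\<Prod>j\<in>J. emeasure D (E j))" for n J E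
    by (subst prod.reindex) (auto simp: inj_on_def)
  have distr_T: "distr ?P ?P (T n) = ?P" for n
    unfolding T_def[abs_def] by (rule distr_PiM_shift) (rule D)
  let ?G = "prod_algebra UNIV (\<lambda>_::int. D)"
  have mixing: "(\<lambda>n. P.prob (A \<inter> (T n -` A \<inter> space ?P))) \<longlonglongrightarrow> P.prob A * P.prob A"
  proof (rule P.measure_preserving_mixing_induct[OF Int_stable_prod_algebra _ _ T distr_T _ A A])
    show "?G \<subseteq> Pow (space ?P)"
      by (simp add: space)
    show "sets ?P = sigma_sets (space ?P) ?G"
      by (simp add: sets_PiM space PiE_UNIV_domain)
    fix B C assume B: "B \<in> ?G" and C: "C \<in> ?G"
    obtain J E where J: "B = cyl J E" "finite J" and E: "\<And>j. j \<in> J \<Longrightarrow> E j \<in> sets D"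
      using prod_algebraE[OF B] emb by metis
    obtain K F where K: "C = cyl K F" "finite K" and F: "\<And>j. j \<in> K \<Longrightarrow> F j \<in> sets D"
      using prod_algebraE[OF C] emb by metis
    \<comment> \<open>From \<open>N\<close> on the shift exceeds every difference of an index in
      \<open>J\<close> and one in \<open>K\<close>. The inserted 0 keeps the maximum meaningful when
      there is no such difference.\<close>
    define N where "N = nat (Max (insert 0 ((\<lambda>(j, k). j - k) ` (J \<times> K)))) + 1"
    have "P.prob (B \<inter> (T n -` C \<inter> space ?P)) = P.prob B * P.prob C" if n: "n \<ge> N" for n
    proof -
      let ?K = "(\<lambda>j. j + int n) ` K"
      have disj: "J \<inter> ?K = {}"
      proof (rule ccontr)
        assume "J \<inter> ?K \<noteq> {}"
        then obtain k where k: "k \<in> K" "k + int n \<in> J" by auto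
        then have "int n \<in> (\<lambda>(j, k). j - k) ` (J \<times> K)"
          by (auto intro!: image_eqI[of _ _ "(k + int n, k)"])
        then have "int n \<le> Max (insert 0 ((\<lambda>(j, k). j - k) ` (J \<times> K)))"
          using J K by (intro Max_ge) auto
        with n show False by (simp add: N_def)
      qed
      \<comment> \<open>On disjoint index sets the two families of constraints can be glued, so the
        intersection is again a cylinder.\<close>
      define H where "H j = (if j \<in> J then E j else F (j - int n))" for j
      have *: "B \<inter> (T n -` C \<inter> space ?P) = cyl (J \<union> ?K) H"
      proof -
        have "j + int n \<notin> J" if "j \<in> K" for j
          using disj that by auto
        then show ?thesis
          unfolding J K Tcyl by (auto simp: cyl_def H_def space ball_Un)
      qed
      have "emeasure ?P (B \<inter> (T n -` C \<inter> space ?P)) = (\<Prod>j\<in>J \<union> ?K. emeasure D (H j))"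
        unfolding * using J K E F by (intro cyl) (auto simp: H_def)
      also have "\<dots> = (\<Prod>j\<in>J. emeasure D (H j)) * (\<Prod>j\<in>?K. emeasure D (H j))"
        using J K disj by (intro prod.union_disjoint) auto
      also have "(\<Prod>j\<in>J. emeasure D (H j)) = emeasure ?P B"
        unfolding J using J(2) E by (subst cyl) (auto simp: H_def)
      also have "(\<Prod>j\<in>?K. emeasure D (H j)) = (\<Prod>j\<in>?K. emeasure D (F (j - int n)))"
        using disj by (intro prod.cong) (auto simp: H_def)
      also have "\<dots> = emeasure ?P C"
        unfolding shift_prod K using K(2) F by (subst cyl) auto
      finally show ?thesis
        by (simp add: P.emeasure_eq_measure ennreal_mult[symmetric])
    qed
    then show "(\<lambda>n. P.prob (B \<inter> (T n -` C \<inter> space ?P))) \<longlonglongrightarrow> P.prob B * P.prob C"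
      by (intro tendsto_eventually) (auto simp: eventually_sequentially)
  qed
  have "T n -` A = A" for n
  proof (induction n)
    case 0
    then show ?case by (simp add: T_def vimage_def)
  next
    case (Suc n)
    have "T (Suc n) -` A = T n -` ((\<lambda>y t. y (t + 1)) -` A)"
      by (simp add: T_def[abs_def] vimage_def algebra_simps)
    then show ?case
      unfolding inv Suc .
  qed
  then have "(\<lambda>n::nat. P.prob A) \<longlonglongrightarrow> P.prob A * P.prob A"
    using mixing by (simp add: space)
  then have "P.prob A = P.prob A * P.prob A"
    using LIMSEQ_unique tendsto_const by blast
  then show ?thesis by simp
qed

section \<open>The recursion along a noise path\<close>

text \<open>Deterministic setting: a noise path \<open>y\<close> is fixed and probability enters
  later. Positive \<open>p\<close> and \<open>q\<close> keep the rows \<open>0\<close>,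
  \<open>q\<close> and \<open>2 * q\<close> distinct and inside the matrix.\<close>

locale as_log_garch =
  fixes p q :: nat and \<omega> :: real and \<omega>m \<alpha>p \<alpha>m \<beta> :: "nat \<Rightarrow> real"
  assumes p_pos: "p > 0" and q_pos: "q > 0"
begin

abbreviation dim :: nat where "dim \<equiv> 2 * q + p"

abbreviation coef_mat :: "real \<Rightarrow> real mat" where
  "coef_mat \<equiv> as_log_garch_mat p q \<alpha>p \<alpha>m \<beta>"

text \<open>The product of \<open>k\<close> matrices at times \<open>t\<close>,
  \<open>t - 1\<close>, ..., \<open>t - k + 1\<close>. Unlike \<open>backward_prod\<close> it is
  anchored at its latest time.\<close>

fun noise_prod :: "(int \<Rightarrow> real) \<Rightarrow> int \<Rightarrow> nat \<Rightarrow> real mat" where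
  "noise_prod y t 0 = 1\<^sub>m dim"
| "noise_prod y t (Suc k) = coef_mat (y t) * noise_prod y (t - 1) k"

text \<open>A positive volatility gives the solution the sign of the noise, so these indicators can
  be read off \<open>y\<close>.\<close>

definition intercept :: "(int \<Rightarrow> real) \<Rightarrow> int \<Rightarrow> real" where
  "intercept y t = \<omega> + (\<Sum>i=1..q. \<omega>m i * of_bool (y (t - int i) < 0))"

text \<open>Rows \<open>0\<close> and \<open>q\<close> carry
  \<open>log e^2 = log s^2 + log y^2\<close> and thus an additional logarithm of the noise; row
  \<open>2 * q\<close> carries \<open>log s^2\<close> itself.\<close>

definition forcing :: "(int \<Rightarrow> real) \<Rightarrow> int \<Rightarrow> nat \<Rightarrow> real" where
  "forcing y t i =
     (if i = 0 then of_bool (y t > 0) * (intercept y t + ln ((y t)\<^sup>2))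
      else if i = q then of_bool (y t < 0) * (intercept y t + ln ((y t)\<^sup>2))
      else if i = 2 * q then intercept y t
      else 0)"

text \<open>For a noise path along which this series diverges, the value is arbitrary; it is still a
  measurable function of the noise up to time \<open>t\<close>.\<close>

definition state :: "(int \<Rightarrow> real) \<Rightarrow> int \<Rightarrow> nat \<Rightarrow> real" where
  "state y t i = (\<Sum>k. mat_apply dim (noise_prod y t k) (forcing y (t - int k)) i)"

text \<open>Component \<open>2 * q\<close> of the state is the logarithm of the squared volatility,
  whence the half.\<close>

definition vol :: "(int \<Rightarrow> real) \<Rightarrow> int \<Rightarrow> real" where
  "vol y t = exp (state y t (2 * q) / 2)"

definition sol :: "(int \<Rightarrow> real) \<Rightarrow> int \<Rightarrow> real" where
  "sol y t = vol y t * y t"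

text \<open>The model along one path, in the very shape of \<open>as_log_garch_solution\<close>, so
  that the two match by unfolding.\<close>

definition solves :: "(int \<Rightarrow> real) \<Rightarrow> (int \<Rightarrow> real) \<Rightarrow> (int \<Rightarrow> real) \<Rightarrow> bool" where
  "solves y e s \<longleftrightarrow> (\<forall>t. s t > 0 \<and> e t = s t * y t \<and>
     ln ((s t)\<^sup>2) =
            \<omega> + (\<Sum>i=1..q. \<omega>m i * of_bool (e (t - int i) < 0))
              + (\<Sum>j=1..p. \<beta> j * ln ((s (t - int j))\<^sup>2))
              + (\<Sum>i=1..q. (\<alpha>p i * of_bool (e (t - int i) > 0)
                            + \<alpha>m i * of_bool (e (t - int i) < 0))
                          * ln ((e (t - int i))\<^sup>2)))"

text \<open>The vector \<open>(1\<^bsub>e>0\<^esub> log e\<^sup>2, 1\<^bsub>e<0\<^esub> log e\<^sup>2, log s\<^sup>2)\<close> with \<open>q\<close>, \<open>q\<close> and \<open>p\<close> lags, the most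
  recent one first. It turns the model into \<open>z\<^sub>t = C\<^sub>t z\<^sub>t\<^sub>-\<^sub>1 + b\<^sub>t\<close> with \<open>b\<^sub>t = forcing y t\<close>.\<close>

definition sol_state :: "(int \<Rightarrow> real) \<Rightarrow> (int \<Rightarrow> real) \<Rightarrow> int \<Rightarrow> nat \<Rightarrow> real" where
  "sol_state e s t i =
     (if i < q then of_bool (e (t - int i) > 0) * ln ((e (t - int i))\<^sup>2)
      else if i < 2 * q then of_bool (e (t - int (i - q)) < 0) * ln ((e (t - int (i - q)))\<^sup>2)
      else ln ((s (t - int (i - 2 * q)))\<^sup>2))"

text \<open>What holds along almost every path and makes the series converge: geometric decay of the
  products against subexponential growth of the logarithms. Nonzero noise lets \<open>ln\<close> of
  a product split.\<close>

definition regular :: "(int \<Rightarrow> real) \<Rightarrow> bool" where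
  "regular y \<longleftrightarrow>
     (\<forall>t. y t \<noteq> 0) \<and>
     (\<forall>t. \<exists>K r. 0 < r \<and> r < 1 \<and>
        (\<forall>k. \<forall>i<dim. \<forall>j<dim. \<bar>noise_prod y t k $$ (i, j)\<bar> \<le> K * r ^ k)) \<and>
     (\<forall>t. \<forall>c>1. \<exists>K. \<forall>k. \<bar>ln ((y (t - int k))\<^sup>2)\<bar> \<le> K * c ^ k)"

lemma coef_mat_carrier [simp]: "coef_mat h \<in> carrier_mat dim dim"
  by (simp add: as_log_garch_mat_def)

lemma noise_prod_carrier [simp]: "noise_prod y t k \<in> carrier_mat dim dim"
  by (induction k arbitrary: t) (auto intro: mult_carrier_mat[where n = dim])

lemma noise_prod_add:
  "noise_prod y t (k + l) = noise_prod y t k * noise_prod y (t - int k) l"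
proof (induction k arbitrary: t)
  case 0
  then show ?case
    using left_mult_one_mat[OF noise_prod_carrier] by simp
next
  case (Suc k)
  show ?case
    using Suc[of "t - 1"] assoc_mult_mat[OF coef_mat_carrier noise_prod_carrier noise_prod_carrier]
    by (simp add: algebra_simps)
qed

lemma noise_prod_shift: "noise_prod (\<lambda>s. y (s + h)) t k = noise_prod y (t + h) k"
  by (induction k arbitrary: t) (simp_all add: algebra_simps)

text \<open>Moving time by \<open>t - k\<close> takes the window \<open>1, ..., k\<close> of the
  Lyapunov exponent to the \<open>k\<close> times that end at \<open>t\<close>.\<close>

lemma backward_prod_eq_noise_prod:
  "backward_prod dim (\<lambda>s. coef_mat (y (s + t - int k))) k = noise_prod y t k"
proof (induction k arbitrary: t)
  case (Suc k)
  have "backward_prod dim (\<lambda>s. coef_mat (y (s + t - int (Suc k)))) k = noise_prod y (t - 1) k"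
    using Suc[of "t - 1"] by (simp add: algebra_simps)
  then show ?case by simp
qed simp

text \<open>This equivariance is what passes stationarity and ergodicity on from the noise.\<close>

lemma sol_shift: "sol (\<lambda>s. y (s + h)) = (\<lambda>t. sol y (t + h))"
proof -
  have f: "forcing (\<lambda>s. y (s + h)) u = forcing y (u + h)" for u
    by (simp add: forcing_def intercept_def fun_eq_iff algebra_simps)
  show ?thesis
    by (simp add: fun_eq_iff sol_def vol_def state_def noise_prod_shift f algebra_simps)
qed

text \<open>The common row vector of rows \<open>0\<close>, \<open>q\<close> and
  \<open>2 * q\<close>, applied to \<open>v\<close>. The coefficients are numbered from 1 and the
  components from 0.\<close>

definition feedback :: "(nat \<Rightarrow> real) \<Rightarrow> real" where
  "feedback v = (\<Sum>j=1..q. \<alpha>p j * v (j - 1)) + (\<Sum>j=1..q. \<alpha>m j * v (q + (j - 1)))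
     + (\<Sum>j=1..p. \<beta> j * v (2 * q + (j - 1)))"

lemma mat_apply_coef_mat:
  assumes "i < dim"
  shows "mat_apply dim (coef_mat h) v i =
    (if i = 0 then of_bool (h > 0) * feedback v
     else if i = q then of_bool (h < 0) * feedback v
     else if i = 2 * q then feedback v else v (i - 1))"
proof -
  have shift: "(\<Sum>j=1..m. f j * g (j - 1)) = (\<Sum>j<m. f (j + 1) * g j)" for m and f g :: "nat \<Rightarrow> real"
    by (rule sum.reindex_bij_witness[of _ "\<lambda>j. j + 1" "\<lambda>j. j - 1"]) auto
  have split: "(\<Sum>j<a + b. f j) = (\<Sum>j<a. f j) + (\<Sum>j<b. f (a + j))" for a b and f :: "nat \<Rightarrow> real"
    by (induction b) (simp_all add: add.assoc)
  have R: "(\<Sum>j<dim. as_log_garch_row q \<alpha>p \<alpha>m \<beta> j * v j) = feedback v"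
  proof -
    have "(\<Sum>j<dim. as_log_garch_row q \<alpha>p \<alpha>m \<beta> j * v j)
      = (\<Sum>j<q + q + p. as_log_garch_row q \<alpha>p \<alpha>m \<beta> j * v j)"
      by (simp add: mult_2)
    also have "\<dots> = (\<Sum>j<q. \<alpha>p (j + 1) * v j) + (\<Sum>j<q. \<alpha>m (j + 1) * v (q + j))
        + (\<Sum>j<p. \<beta> (j + 1) * v (2 * q + j))"
      unfolding split
      by (intro arg_cong2[where f = "(+)"] sum.cong) (auto simp: as_log_garch_row_def mult_2)
    also have "\<dots> = feedback v"
      unfolding feedback_def shift shift[of \<alpha>m "\<lambda>j. v (q + j)"] shift[of \<beta> "\<lambda>j. v (2 * q + j)"] ..
    finally show ?thesis .
  qed
  have unit: "(\<Sum>j<dim. of_bool (i = j + 1) * v j) = v (i - 1)" if "i \<noteq> 0"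
  proof -
    have "(\<Sum>j<dim. of_bool (i = j + 1) * v j) = (\<Sum>j<dim. if j = i - 1 then v j else 0)"
      using that by (intro sum.cong) auto
    then show ?thesis using assms(1) by simp
  qed
  have "mat_apply dim (coef_mat h) v i = (\<Sum>j<dim.
      (if i = 0 then of_bool (h > 0) * as_log_garch_row q \<alpha>p \<alpha>m \<beta> j
       else if i = q then of_bool (h < 0) * as_log_garch_row q \<alpha>p \<alpha>m \<beta> j
       else if i = 2 * q then as_log_garch_row q \<alpha>p \<alpha>m \<beta> j
       else of_bool (i = j + 1)) * v j)"
    using assms(1) unfolding mat_apply_def by (intro sum.cong) (auto simp: as_log_garch_mat_def)
  then show ?thesis
    using unit unfolding R[symmetric] by (simp add: sum_distrib_left mult.assoc del: of_bool_eq_iff)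
qed

lemma feedback_cong: "(\<And>i. i < dim \<Longrightarrow> v i = w i) \<Longrightarrow> feedback v = feedback w"
  unfolding feedback_def
  by (intro arg_cong2[where f = "(+)"] sum.cong arg_cong2[where f = "(*)"] refl) auto

lemma feedback_sol_state:
  "feedback (sol_state e s (t - 1)) =
      (\<Sum>i=1..q. \<alpha>p i * (of_bool (e (t - int i) > 0) * ln ((e (t - int i))\<^sup>2)))
      + (\<Sum>i=1..q. \<alpha>m i * (of_bool (e (t - int i) < 0) * ln ((e (t - int i))\<^sup>2)))
      + (\<Sum>j=1..p. \<beta> j * ln ((s (t - int j))\<^sup>2))"
proof -
  have *: "t - 1 - int (j - 1) = t - int j" if "j \<ge> 1" for j
    using that by simp
  show ?thesis
    unfolding feedback_def sol_state_def
    by (intro arg_cong2[where f = "(+)"] sum.cong) (auto simp: *)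
qed

text \<open>Rows \<open>0\<close>, \<open>q\<close> and \<open>2 * q\<close> express the model
  equation, the first two after splitting \<open>ln (e^2)\<close>. The other rows only pass a lag
  on.\<close>

lemma sol_state_rec:
  assumes "solves y e s" and y: "\<And>t. y t \<noteq> 0" and i: "i < dim"
  shows "sol_state e s t i = mat_apply dim (coef_mat (y t)) (sol_state e s (t - 1)) i + forcing y t i"
proof -
  have s: "s u > 0" and e: "e u = s u * y u" for u
    using assms by (auto simp: solves_def)
  have sign: "e u > 0 \<longleftrightarrow> y u > 0" "e u < 0 \<longleftrightarrow> y u < 0" for u
    using s[of u] by (auto simp: e zero_less_mult_iff mult_less_0_iff)
  have lne: "ln ((e u)\<^sup>2) = ln ((s u)\<^sup>2) + ln ((y u)\<^sup>2)" for u
    using s[of u] y[of u] by (simp add: e power_mult_distrib ln_mult)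
  note feedback_sol_state[of e s t]
  moreover have "ln ((s t)\<^sup>2) = \<omega> + (\<Sum>i=1..q. \<omega>m i * of_bool (e (t - int i) < 0))
              + (\<Sum>j=1..p. \<beta> j * ln ((s (t - int j))\<^sup>2))
              + (\<Sum>i=1..q. (\<alpha>p i * of_bool (e (t - int i) > 0)
                            + \<alpha>m i * of_bool (e (t - int i) < 0))
                          * ln ((e (t - int i))\<^sup>2))"
    using assms(1) unfolding solves_def by blast
  ultimately have main: "ln ((s t)\<^sup>2) = feedback (sol_state e s (t - 1)) + intercept y t"
    by (simp add: intercept_def sign distrib_right sum.distrib mult.assoc)
  consider "i = 0" | "i = q" "i \<noteq> 0" | "i = 2 * q" "i \<noteq> 0" | "i \<noteq> 0" "i \<noteq> q" "i \<noteq> 2 * q"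
    by blast
  then show ?thesis
  proof cases
    case 1
    then show ?thesis
      using q_pos main lne[of t]
      unfolding mat_apply_coef_mat[OF i] by (simp add: forcing_def sol_state_def[of e s t] sign algebra_simps)
  next
    case 2
    then show ?thesis
      using q_pos main lne[of t]
      unfolding mat_apply_coef_mat[OF i] by (simp add: forcing_def sol_state_def[of e s t] sign algebra_simps)
  next
    case 3
    then show ?thesis
      using q_pos main
      unfolding mat_apply_coef_mat[OF i] by (simp add: forcing_def sol_state_def[of e s t])
  next
    case 4
    \<comment> \<open>As \<open>i\<close> heads no block, the components \<open>i\<close> and
      \<open>i - 1\<close> lie in the same block and differ by one lag.\<close>
    then have eq: "t - 1 - int (i - 1) = t - int i"
      "i \<ge> q \<Longrightarrow> t - 1 - int (i - 1 - q) = t - int (i - q)"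
      "i \<ge> 2 * q \<Longrightarrow> t - 1 - int (i - 1 - 2 * q) = t - int (i - 2 * q)"
      by auto
    have lt: "i - 1 < q \<longleftrightarrow> i < q" "i - 1 < 2 * q \<longleftrightarrow> i < 2 * q"
      using 4 by auto
    have "sol_state e s t i = sol_state e s (t - 1) (i - 1)"
      unfolding sol_state_def lt by (cases "i < q"; cases "i < 2 * q") (simp_all only: eq if_True if_False not_less)
    then show ?thesis
      using 4 by (simp add: mat_apply_coef_mat[OF i] forcing_def)
  qed
qed

text \<open>The entries of the products decay like \<open>r ^ k\<close>, while the forcing grows at
  most like \<open>c ^ k\<close> for any prescribed \<open>c > 1\<close>; a comparison with a
  geometric series suffices.\<close>

lemma state_summable:
  assumes y: "regular y" and i: "i < dim"
  shows "summable (\<lambda>k. mat_apply dim (noise_prod y t k) (forcing y (t - int k)) i)"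
proof -
  obtain K r where r: "0 < r" "r < 1"
    and K: "\<And>k i j. i < dim \<Longrightarrow> j < dim \<Longrightarrow> \<bar>noise_prod y t k $$ (i, j)\<bar> \<le> K * r ^ k"
    using y[unfolded regular_def, THEN conjunct2, THEN conjunct1, rule_format, of t] by metis
  \<comment> \<open>This growth rate balances the decay: \<open>c * r = sqrt r < 1\<close>.\<close>
  define c where "c = 1 / sqrt r"
  have c: "c > 1" "c * r = sqrt r"
    using r real_div_sqrt[of r] by (simp_all add: c_def)
  obtain L where L: "\<And>k. \<bar>ln ((y (t - int k))\<^sup>2)\<bar> \<le> L * c ^ k"
    using y[unfolded regular_def, THEN conjunct2, THEN conjunct2, rule_format, OF c(1), of t] by metis
  define D where "D = \<bar>\<omega>\<bar> + (\<Sum>i=1..q. \<bar>\<omega>m i\<bar>)"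
  have D: "\<bar>intercept y u\<bar> \<le> D" for u
  proof -
    have "\<bar>\<Sum>i=1..q. \<omega>m i * of_bool (y (u - int i) < 0)\<bar> \<le> (\<Sum>i=1..q. \<bar>\<omega>m i\<bar>)"
      by (rule order_trans[OF sum_abs], rule sum_mono) (simp add: of_bool_def)
    then show ?thesis unfolding intercept_def D_def by linarith
  qed
  have f: "\<bar>forcing y (t - int k) j\<bar> \<le> (D + L) * c ^ k" for k j
  proof -
    have "1 \<le> c ^ k"
      using c(1) by simp
    moreover have "0 \<le> D"
      by (simp add: D_def sum_nonneg)
    ultimately have Dc: "D \<le> D * c ^ k"
      using mult_left_mono[of 1 "c ^ k" D] by simp
    have "\<bar>forcing y (t - int k) j\<bar> \<le> \<bar>intercept y (t - int k)\<bar> + \<bar>ln ((y (t - int k))\<^sup>2)\<bar>"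
      by (simp add: forcing_def of_bool_def abs_triangle_ineq)
    also have "\<dots> \<le> D + L * c ^ k"
      using D[of "t - int k"] L[of k] by simp
    finally have "\<bar>forcing y (t - int k) j\<bar> \<le> D + L * c ^ k" .
    with Dc show ?thesis by (simp add: distrib_right)
  qed
  have bound: "norm (mat_apply dim (noise_prod y t k) (forcing y (t - int k)) i)
      \<le> real dim * K * (D + L) * sqrt r ^ k" for k
    using abs_mat_apply_le[of dim "noise_prod y t k" i "K * r ^ k" "forcing y (t - int k)" "(D + L) * c ^ k",
        OF K[OF i] f]
    unfolding c(2)[symmetric] power_mult_distrib real_norm_def by (simp only: mult_ac)
  have "summable (\<lambda>k. real dim * K * (D + L) * sqrt r ^ k)"
    using r by (intro summable_mult summable_geometric) auto
  then show ?thesis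
    by (rule summable_comparison_test') (rule bound)
qed

text \<open>The term \<open>k = 0\<close> is the forcing, and the matrix at time \<open>t\<close>
  factors out of all later terms.\<close>

lemma state_rec:
  assumes y: "regular y" and i: "i < dim"
  shows "state y t i = mat_apply dim (coef_mat (y t)) (state y (t - 1)) i + forcing y t i"
proof -
  let ?f = "\<lambda>t k. mat_apply dim (noise_prod y t k) (forcing y (t - int k))"
  have Suc: "?f t (Suc k) i = mat_apply dim (coef_mat (y t)) (?f (t - 1) k) i" for k
    using mat_apply_mult[OF coef_mat_carrier noise_prod_carrier i] by (simp add: algebra_simps)
  have "state y t i = ?f t 0 i + (\<Sum>k. ?f t (Suc k) i)"
    unfolding state_def using suminf_split_head[OF state_summable[OF y i, of t]] by simp
  also have "(\<Sum>k. ?f t (Suc k) i) = mat_apply dim (coef_mat (y t)) (state y (t - 1)) i"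
    unfolding Suc mat_apply_def[of dim "coef_mat (y t)"] state_def
    by (subst suminf_sum)
      (auto intro!: summable_mult state_summable[OF y] sum.cong suminf_mult simp del: noise_prod.simps)
  finally show ?thesis
    using i by (simp add: mat_apply_one)
qed

text \<open>Converse of \<open>sol_state_rec\<close>. The heads of the three blocks are identified
  from rows \<open>0\<close>, \<open>q\<close> and \<open>2 * q\<close>, the lag rows then show that
  \<open>state\<close> consists of lagged values of the solution, and row \<open>2 * q\<close>
  becomes the model equation.\<close>

lemma solves_sol:
  assumes y: "regular y"
  shows "solves y (sol y) (vol y)"
proof -
  have y0: "y t \<noteq> 0" for t
    using y by (simp add: regular_def)
  have vol: "vol y t > 0" "ln ((vol y t)\<^sup>2) = state y t (2 * q)" for t
    by (simp_all add: vol_def ln_realpow)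
  have sign: "sol y u > 0 \<longleftrightarrow> y u > 0" "sol y u < 0 \<longleftrightarrow> y u < 0" for u
    using vol(1)[of u] by (auto simp: sol_def zero_less_mult_iff mult_less_0_iff)
  have lnsol: "ln ((sol y u)\<^sup>2) = state y u (2 * q) + ln ((y u)\<^sup>2)" for u
    using vol[of u] y0[of u] by (simp add: sol_def power_mult_distrib ln_mult)
  note rec = state_rec[OF y] mat_apply_coef_mat
  have st2q: "state y t (2 * q) = feedback (state y (t - 1)) + intercept y t" for t
    using p_pos q_pos by (subst rec(1)) (auto simp: rec(2) forcing_def)
  have st0: "state y t 0 = of_bool (sol y t > 0) * ln ((sol y t)\<^sup>2)" for t
    unfolding lnsol using p_pos q_pos
    by (subst rec(1)) (auto simp: rec(2) st2q forcing_def sign)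
  have stq: "state y t q = of_bool (sol y t < 0) * ln ((sol y t)\<^sup>2)" for t
    unfolding lnsol using p_pos q_pos
    by (subst rec(1)) (auto simp: rec(2) st2q forcing_def sign)
  have shift: "state y t (a + j) = state y (t - int j) a"
    if "a + j < dim" "a = 0 \<and> j < q \<or> a = q \<and> j < q \<or> a = 2 * q" for t a j
    using that
  proof (induction j arbitrary: t)
    case (Suc j)
    have "state y t (a + Suc j) = state y (t - 1) (a + j)"
      using Suc.prems by (subst rec(1)) (auto simp: rec(2) forcing_def)
    also have "\<dots> = state y (t - 1 - int j) a"
      using Suc by (intro Suc.IH) auto
    finally show ?case by (simp add: algebra_simps)
  qed simp
  have eq: "state y t i = sol_state (sol y) (vol y) t i" if "i < dim" for t i
  proof -
    consider "i < q" | "q \<le> i" "i < 2 * q" | "2 * q \<le> i" by linarith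
    then show ?thesis
    proof cases
      case 1
      then show ?thesis
        using shift[of 0 i t] that by (simp add: sol_state_def st0)
    next
      case 2
      then show ?thesis
        using shift[of q "i - q" t] that by (simp add: sol_state_def stq)
    next
      case 3
      then show ?thesis
        using shift[of "2 * q" "i - 2 * q" t] that by (simp add: sol_state_def vol)
    qed
  qed
  have "feedback (state y (t - 1)) = feedback (sol_state (sol y) (vol y) (t - 1))" for t
    by (rule feedback_cong) (rule eq)
  note feedback = this[unfolded feedback_sol_state]
  have "ln ((vol y t)\<^sup>2) =
            \<omega> + (\<Sum>i=1..q. \<omega>m i * of_bool (sol y (t - int i) < 0))
              + (\<Sum>j=1..p. \<beta> j * ln ((vol y (t - int j))\<^sup>2))
              + (\<Sum>i=1..q. (\<alpha>p i * of_bool (sol y (t - int i) > 0)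
                            + \<alpha>m i * of_bool (sol y (t - int i) < 0))
                          * ln ((sol y (t - int i))\<^sup>2))" for t
    unfolding vol(2)[of t] st2q[of t] feedback
    by (simp add: intercept_def sign distrib_right sum.distrib mult.assoc)
  moreover have "sol y t = vol y t * y t" for t
    by (rule sol_def)
  ultimately show ?thesis
    unfolding solves_def using vol(1) by blast
qed

end

section \<open>Geometric rates and one-dimensional marginals\<close>

lemma geometric_bound_from_blocks:
  fixes f :: "nat \<Rightarrow> real"
  assumes "l > 0" and r: "0 < r" "r < 1" and block: "\<And>m. f (m * l) \<le> K * r ^ m"
    and step: "\<And>k j. j < l \<Longrightarrow> f (k + j) \<le> f k * D" and nonneg: "\<And>k. 0 \<le> f k" "0 \<le> D"
  shows "\<exists>K r. 0 < r \<and> r < 1 \<and> (\<forall>k. f k \<le> K * r ^ k)"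
proof -
  define \<rho> where "\<rho> = root l r"
  have \<rho>: "0 < \<rho>" "\<rho> < 1" "\<rho> ^ l = r"
    using assms by (simp_all add: \<rho>_def)
  have "0 \<le> K"
    using block[of 0] nonneg(1)[of 0] by simp
  \<comment> \<open>Since \<open>k < m * l + l\<close>, the power \<open>\<rho> ^ (m * l)\<close> is
    at most \<open>\<rho> ^ k / \<rho> ^ l\<close>, which accounts for the divisor in the
    constant.\<close>
  have "f k \<le> K * D / \<rho> ^ l * \<rho> ^ k" for k
  proof -
    define m j where "m = k div l" and "j = k mod l"
    have k: "k = m * l + j" "j < l"
      using \<open>l > 0\<close> by (auto simp: m_def j_def)
    have "f k \<le> f (m * l) * D"
      unfolding k(1) by (rule step) (rule k)
    also have "\<dots> \<le> K * r ^ m * D"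
      using block nonneg by (intro mult_right_mono) auto
    also have "r ^ m = \<rho> ^ (m * l)"
      by (simp add: \<rho>(3)[symmetric] power_mult[symmetric] mult.commute)
    also have "\<rho> ^ (m * l) \<le> \<rho> ^ k / \<rho> ^ l"
    proof -
      have "\<rho> ^ (m * l + l) \<le> \<rho> ^ k"
        using \<rho> k by (intro power_decreasing) auto
      then show ?thesis
        using \<rho> r by (simp add: power_add pos_le_divide_eq)
    qed
    finally show ?thesis
      using nonneg \<open>0 \<le> K\<close> by (simp add: mult_left_mono mult_right_mono mult_ac)
  qed
  then show ?thesis using \<rho> by blast
qed

lemma strictly_stationary_distr:
  assumes "strictly_stationary M X"
  shows "distr M borel (X t) = distr M borel (X 0)"
proof -
  have X: "X t \<in> borel_measurable M" for t
    using assms by (simp add: strictly_stationary_def)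
  have *: "distr M borel (X u) = distr (path_law M (\<lambda>s. X (s + u))) borel (\<lambda>y. y 0)" for u
    unfolding path_law_def
    by (subst distr_distr) (auto intro!: measurable_PiM_single' X simp: space_PiM comp_def)
  have "path_law M (\<lambda>s. X (s + t)) = path_law M (\<lambda>s. X (s + 0))"
    using assms by (simp add: strictly_stationary_def)
  then show ?thesis
    unfolding *[of t] *[of 0] by simp
qed

lemma prob_abs_gt_identically_distributed:
  fixes U V :: "'a \<Rightarrow> real"
  assumes "U \<in> borel_measurable M" "V \<in> borel_measurable M" "distr M borel U = distr M borel V"
    and [measurable]: "g \<in> borel_measurable borel"
  shows "measure M {x \<in> space M. L < \<bar>g (U x) :: real\<bar>} = measure M {x \<in> space M. L < \<bar>g (V x)\<bar>}"
proof -
  have *: "measure M {x \<in> space M. L < \<bar>g (W x)\<bar>} = measure (distr M borel W) {z. L < \<bar>g z\<bar>}"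
    if "W \<in> borel_measurable M" for W
    using that by (subst measure_distr) (auto intro!: arg_cong[where f = "measure M"])
  show ?thesis
    using assms(1-3) by (simp add: *)
qed

section \<open>Measurability and bounds along a noise path\<close>

context as_log_garch
begin

text \<open>The matrix takes only three values. Hence no sigma-algebra on matrices is required for
  measurability, and norms of products of a fixed length are bounded uniformly over all
  paths.\<close>

lemma coef_mat_sgn: "coef_mat h = (if h > 0 then coef_mat 1 else if h < 0 then coef_mat (- 1) else coef_mat 0)"
  unfolding as_log_garch_mat_def by (cases h "0 :: real" rule: linorder_cases) (auto intro!: eq_matI)

lemma noise_prod_cong:
  "(\<And>u. t - int k < u \<Longrightarrow> u \<le> t \<Longrightarrow> y u = z u) \<Longrightarrow> noise_prod y t k = noise_prod z t k"
  by (induction k arbitrary: t) auto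

text \<open>Signs of the noise select among finitely many matrices, so any real function
  \<open>f\<close> of the product is measurable. The induction absorbs each new factor into
  \<open>f\<close>.\<close>

lemma measurable_noise_prod:
  assumes "\<And>u. t - int k < u \<Longrightarrow> u \<le> t \<Longrightarrow> (\<lambda>x. y x u) \<in> borel_measurable S"
  shows "(\<lambda>x. f (noise_prod (y x) t k) :: real) \<in> borel_measurable S"
  using assms
proof (induction k arbitrary: t f)
  case (Suc k)
  have [measurable]: "(\<lambda>x. y x t) \<in> borel_measurable S"
    by (rule Suc.prems) auto
  have [measurable]: "(\<lambda>x. f (coef_mat h * noise_prod (y x) (t - 1) k)) \<in> borel_measurable S" for h
    by (rule Suc.IH) (auto intro: Suc.prems)
  have *: "f (noise_prod (y x) t (Suc k)) =
      (if y x t > 0 then f (coef_mat 1 * noise_prod (y x) (t - 1) k)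
       else if y x t < 0 then f (coef_mat (- 1) * noise_prod (y x) (t - 1) k)
       else f (coef_mat 0 * noise_prod (y x) (t - 1) k))" for x
    unfolding noise_prod.simps by (subst coef_mat_sgn) auto
  show ?case
    unfolding * by measurable
qed simp

text \<open>The general \<open>S\<close>, constrained only at times up to \<open>t\<close>, covers
  the path space and the past of the noise alike.\<close>

lemma measurable_vol:
  assumes "\<And>u. u \<le> t \<Longrightarrow> (\<lambda>x. y x u) \<in> borel_measurable S"
  shows "(\<lambda>x. vol (y x) t) \<in> borel_measurable S"
proof -
  have [measurable]: "(\<lambda>x. y x (t - int k)) \<in> borel_measurable S"
      "(\<lambda>x. y x (t - int k - int i)) \<in> borel_measurable S" for i k
    by (auto intro: assms)
  have [measurable]: "(\<lambda>x. noise_prod (y x) t k $$ (i, j)) \<in> borel_measurable S" for k i j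
    by (rule measurable_noise_prod) (rule assms)
  have "(\<lambda>x. intercept (y x) (t - int k)) \<in> borel_measurable S" for k
    unfolding intercept_def by measurable
  note [measurable] = this
  have "(\<lambda>x. forcing (y x) (t - int k) i) \<in> borel_measurable S" for k i
    unfolding forcing_def by measurable
  note [measurable] = this
  show ?thesis
    unfolding vol_def state_def mat_apply_def by measurable
qed

lemma measurable_sol:
  assumes "\<And>u. u \<le> t \<Longrightarrow> (\<lambda>x. y x u) \<in> borel_measurable S"
  shows "(\<lambda>x. sol (y x) t) \<in> borel_measurable S"
  unfolding sol_def using measurable_vol[OF assms] assms[of t] by simp

lemma measurable_sol_state:
  assumes [measurable]: "\<And>u. e u \<in> borel_measurable S" "\<And>u. s u \<in> borel_measurable S"
  shows "(\<lambda>x. sol_state (\<lambda>u. e u x) (\<lambda>u. s u x) t i) \<in> borel_measurable S"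
  unfolding sol_state_def by measurable

lemma matrix_norm_noise_prod_add:
  assumes "matrix_norm dim N"
  shows "N (noise_prod y t (k + l)) \<le> N (noise_prod y t k) * N (noise_prod y (t - int k) l)"
  using assms by (simp add: noise_prod_add matrix_norm_def)

lemma matrix_norm_noise_prod_nonneg: "matrix_norm dim N \<Longrightarrow> 0 \<le> N (noise_prod y t k)"
  by (simp add: matrix_norm_def)

lemma matrix_norm_noise_prod_bounded:
  assumes N: "matrix_norm dim N"
  shows "\<exists>B. \<forall>y t. N (noise_prod y t k) \<le> B"
proof (induction k)
  case (Suc k)
  then obtain B where B: "N (noise_prod y t k) \<le> B" for y t by blast
  define C where "C = max (N (coef_mat 1)) (max (N (coef_mat (- 1))) (N (coef_mat 0)))"
  have C: "N (coef_mat h) \<le> C" for h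
    by (subst coef_mat_sgn) (simp add: C_def le_max_iff_disj)
  have "N (noise_prod y t (Suc k)) \<le> C * B" for y t
  proof -
    have "N (noise_prod y t (Suc k)) \<le> N (coef_mat (y t)) * N (noise_prod y (t - 1) k)"
      using N by (simp add: matrix_norm_def)
    also have "\<dots> \<le> C * B"
    proof (rule mult_mono)
      show "0 \<le> C"
        using N C[of 0] by (auto simp: matrix_norm_def intro: order_trans)
    qed (use B C matrix_norm_noise_prod_nonneg[OF N] in auto)
    finally show ?thesis .
  qed
  then show ?case by blast
qed auto

text \<open>The lag \<open>j\<close> depends on \<open>i\<close> alone and not on the time, which
  makes the resulting tail bounds uniform in \<open>t\<close>. For the volatility block,
  \<open>ln (s^2)\<close> is \<open>ln (e^2) - ln (y^2)\<close>.\<close>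

lemma solves_abs_sol_state_le:
  "\<exists>j. \<forall>y e s t. solves y e s \<longrightarrow> (\<forall>u. y u \<noteq> 0) \<longrightarrow>
    \<bar>sol_state e s t i\<bar> \<le> \<bar>ln ((e (t - int j))\<^sup>2)\<bar> + \<bar>ln ((y (t - int j))\<^sup>2)\<bar>"
proof -
  have lns: "ln ((s u)\<^sup>2) = ln ((e u)\<^sup>2) - ln ((y u)\<^sup>2)" if "solves y e s" "y u \<noteq> 0" for y e s u
  proof -
    have "s u > 0" "e u = s u * y u"
      using that by (auto simp: solves_def)
    then show ?thesis
      using that by (simp add: power_mult_distrib ln_mult)
  qed
  consider "i < q" | "q \<le> i" "i < 2 * q" | "2 * q \<le> i" by linarith
  then show ?thesis
  proof cases
    case 1
    then show ?thesis
      by (intro exI[of _ i]) (simp add: sol_state_def of_bool_def)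
  next
    case 2
    then show ?thesis
      by (intro exI[of _ "i - q"]) (simp add: sol_state_def of_bool_def)
  next
    case 3
    then show ?thesis
      by (intro exI[of _ "i - 2 * q"]) (simp add: sol_state_def lns abs_triangle_ineq4)
  qed
qed

end

section \<open>Random noise\<close>

locale as_log_garch_model = as_log_garch p q \<omega> \<omega>m \<alpha>p \<alpha>m \<beta> + prob_space M
  for p q :: nat and \<omega> :: real and \<omega>m \<alpha>p \<alpha>m \<beta> :: "nat \<Rightarrow> real" and M :: "'a measure" +
  fixes \<eta> :: "int \<Rightarrow> 'a \<Rightarrow> real" and N :: "real mat \<Rightarrow> real"
  assumes indep: "indep_vars (\<lambda>_. borel) \<eta> UNIV"
    and ident: "\<And>t. distr M borel (\<eta> t) = distr M borel (\<eta> 0)"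
    and log_moment: "(\<integral>\<^sup>+ x. e2ennreal (ereal_log_plus \<bar>ereal_log (ereal ((\<eta> 0 x)\<^sup>2))\<bar>) \<partial>M) < \<infinity>"
    and norm: "matrix_norm dim N"
    and lyapunov: "top_lyapunov M dim N (\<lambda>t x. coef_mat (\<eta> t x)) < 0"
begin

abbreviation noise :: "'a \<Rightarrow> int \<Rightarrow> real" where
  "noise x t \<equiv> \<eta> t x"

lemma eta_measurable [measurable]: "\<eta> t \<in> borel_measurable M"
  using indep by (auto simp: indep_vars_def)

text \<open>Real counterpart of the integrand of \<open>log_moment\<close>. It vanishes at
  \<open>z = 0\<close>, where the extended integrand is infinite.\<close>

definition log_plus_abs_log_sq :: "real \<Rightarrow> real" where
  "log_plus_abs_log_sq z = max 0 (ln \<bar>ln (z\<^sup>2)\<bar>)"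

lemma log_plus_abs_log_sq_measurable [measurable]: "log_plus_abs_log_sq \<in> borel_measurable borel"
  unfolding log_plus_abs_log_sq_def[abs_def] by measurable

lemma ereal_log_plus_eq:
  "e2ennreal (ereal_log_plus \<bar>ereal_log (ereal (z\<^sup>2))\<bar>) =
    (if z = 0 then \<infinity> else ennreal (log_plus_abs_log_sq z))"
  by (auto simp: ereal_log_plus_def ereal_log_def log_plus_abs_log_sq_def max_def e2ennreal_neg ennreal_neg)

text \<open>The integrand of \<open>log_moment\<close> is infinite where the noise vanishes, so a
  finite integral excludes this at time 0, and the common law at all other times.\<close>

lemma AE_noise_nonzero: "AE x in M. \<forall>t. \<eta> t x \<noteq> 0"
proof -
  have "AE x in M. e2ennreal (ereal_log_plus \<bar>ereal_log (ereal ((\<eta> 0 x)\<^sup>2))\<bar>) \<noteq> \<infinity>"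
    using log_moment unfolding ereal_log_plus_eq by (intro nn_integral_PInf_AE) auto
  then have "AE x in M. \<eta> 0 x \<noteq> 0"
    unfolding ereal_log_plus_eq by eventually_elim (auto split: if_splits)
  then have "AE z in distr M borel (\<eta> t). z \<noteq> 0" for t
    unfolding ident[of t] by (subst AE_distr_iff) auto
  then have "AE x in M. \<eta> t x \<noteq> 0" for t
    by (subst (asm) AE_distr_iff) auto
  then show ?thesis by (subst AE_all_countable) simp
qed

text \<open>The integrable iterated logarithm grows slower than any line; exponentiating gives
  growth below any \<open>c ^ k\<close>.\<close>

lemma AE_log_noise_subexponential:
  "AE x in M. \<forall>t. \<forall>c>1. \<exists>K. \<forall>k. \<bar>ln ((\<eta> (t - int k) x)\<^sup>2)\<bar> \<le> K * c ^ k"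
proof -
  let ?Y = "\<lambda>t k x. log_plus_abs_log_sq (\<eta> (t - int k) x)"
  have nonneg: "0 \<le> log_plus_abs_log_sq z" for z
    by (simp add: log_plus_abs_log_sq_def)
  have distr_Y: "distr M borel (\<lambda>x. log_plus_abs_log_sq (\<eta> t x))
      = distr (distr M borel (\<eta> 0)) borel log_plus_abs_log_sq" for t
    unfolding ident[of t, symmetric] by (subst distr_distr) (auto simp: comp_def)
  have int: "(\<integral>\<^sup>+ x. ennreal (log_plus_abs_log_sq (\<eta> t x)) \<partial>M) < \<infinity>" for t
  proof -
    have "(\<integral>\<^sup>+ x. ennreal (log_plus_abs_log_sq (\<eta> t x)) \<partial>M)
        = (\<integral>\<^sup>+ z. ennreal (log_plus_abs_log_sq z) \<partial>distr M borel (\<eta> t))"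
      by (subst nn_integral_distr) auto
    also have "\<dots> = (\<integral>\<^sup>+ x. ennreal (log_plus_abs_log_sq (\<eta> 0 x)) \<partial>M)"
      unfolding ident[of t] by (subst nn_integral_distr) auto
    also have "\<dots> \<le> (\<integral>\<^sup>+ x. e2ennreal (ereal_log_plus \<bar>ereal_log (ereal ((\<eta> 0 x)\<^sup>2))\<bar>) \<partial>M)"
      unfolding ereal_log_plus_eq by (intro nn_integral_mono) auto
    finally show ?thesis using log_moment by (rule le_less_trans)
  qed
  \<comment> \<open>Countably many slopes suffice, so that one null set serves all real
    \<open>c > 1\<close>.\<close>
  have "AE x in M. \<exists>K. \<forall>k. ?Y t k x \<le> K + inverse (real (Suc m)) * real k" for t m
    by (rule AE_identically_distributed_sublinear)
      (use int[of t] nonneg in \<open>auto simp: distr_Y\<close>)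
  then have "AE x in M. \<forall>t m. \<exists>K. \<forall>k. ?Y t k x \<le> K + inverse (real (Suc m)) * real k"
    by (simp add: AE_all_countable)
  then show ?thesis
  proof eventually_elim
    case (elim x)
    show ?case
    proof (intro allI impI)
      fix t :: int and c :: real assume c: "c > 1"
      obtain m where m: "inverse (real (Suc m)) < ln c"
        using reals_Archimedean[of "ln c"] c by auto
      obtain K where K: "?Y t k x \<le> K + inverse (real (Suc m)) * real k" for k
        using elim by blast
      have "\<bar>ln ((\<eta> (t - int k) x)\<^sup>2)\<bar> \<le> exp K * c ^ k" for k
      proof -
        let ?a = "\<bar>ln ((\<eta> (t - int k) x)\<^sup>2)\<bar>"
        have "?a \<le> exp (?Y t k x)"
        proof (cases "?a = 0")
          case False
          then have "?a = exp (ln ?a)" by simp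
          also have "\<dots> \<le> exp (?Y t k x)"
            unfolding log_plus_abs_log_sq_def by (subst exp_le_cancel_iff) simp
          finally show ?thesis .
        qed (metis exp_ge_zero)
        also have "\<dots> \<le> exp (K + ln c * real k)"
          using K[of k] mult_right_mono[OF less_imp_le[OF m], of "real k"] by simp
        also have "\<dots> = exp K * c ^ k"
          using c by (simp add: exp_add exp_of_nat2_mult)
        finally show ?thesis .
      qed
      then show "\<exists>K. \<forall>k. \<bar>ln ((\<eta> (t - int k) x)\<^sup>2)\<bar> \<le> K * c ^ k" by blast
    qed
  qed
qed

lemma path_measurable [measurable]: "(\<lambda>x t. \<eta> (t + h) x) \<in> measurable M (Pi\<^sub>M UNIV (\<lambda>_. borel))"
  by (rule measurable_PiM_single') (auto simp: space_PiM)

lemma path_distr: "distr M (Pi\<^sub>M UNIV (\<lambda>_. borel)) (\<lambda>x t. \<eta> (t + h) x) = Pi\<^sub>M UNIV (\<lambda>_. distr M borel (\<eta> 0))"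
  by (rule iid_path_distr[OF prob_space_axioms indep ident])

text \<open>The negative infimum provides one block length \<open>l\<close> with negative mean
  logarithm. Going back from \<open>t\<close>, successive blocks of this length are independent with
  a common fractional moment below 1, and an incomplete last block costs at most the factor
  \<open>D\<close>.\<close>

lemma AE_noise_prod_geometric:
  "AE x in M. \<exists>K r. 0 < r \<and> r < 1 \<and> (\<forall>k. \<forall>i<dim. \<forall>j<dim. \<bar>noise_prod (noise x) t k $$ (i, j)\<bar> \<le> K * r ^ k)"
proof -
  obtain l where l: "l \<ge> 1" and "ereal (1 / real l) *
      ereal_expectation M (\<lambda>x. ereal_log (ereal (N (backward_prod dim (\<lambda>s. coef_mat (\<eta> s x)) l)))) < 0"
    using lyapunov unfolding top_lyapunov_def INF_less_iff by auto
  moreover have "backward_prod dim (\<lambda>s. coef_mat (\<eta> s x)) l = noise_prod (noise x) (int l) l" for x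
    using backward_prod_eq_noise_prod[of "noise x" "int l" l] by simp
  ultimately have neg: "ereal_expectation M (\<lambda>x. ereal_log (ereal (N (noise_prod (noise x) (int l) l)))) < 0"
    by (auto simp: not_le[symmetric] intro: ereal_0_le_mult)
  obtain B where B: "\<And>y t. N (noise_prod y t l) \<le> B"
    using matrix_norm_noise_prod_bounded[OF norm] by blast
  have meas: "(\<lambda>x. N (noise_prod (noise x) u k)) \<in> borel_measurable M" for u k
    by (rule measurable_noise_prod) simp
  obtain s \<rho> where s: "s > 0" and \<rho>: "0 < \<rho>" "\<rho> < 1"
    and moment: "(\<integral>\<^sup>+ x. ennreal (N (noise_prod (noise x) (int l) l) powr s) \<partial>M) \<le> ennreal \<rho>"
    using powr_moment_less_one[OF meas matrix_norm_noise_prod_nonneg[OF norm] B neg] by blast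
  define X where "X j x = N (noise_prod (noise x) (t - int (j * l)) l)" for j x
  have momentX: "(\<integral>\<^sup>+ x. ennreal (X j x powr s) \<partial>M) \<le> ennreal \<rho>" for j
  proof -
    let ?G = "\<lambda>y. ennreal (N (noise_prod y (int l) l) powr s)"
    have [measurable]: "(\<lambda>y. N (noise_prod y (int l) l)) \<in> borel_measurable (Pi\<^sub>M UNIV (\<lambda>_. borel))"
      by (rule measurable_noise_prod) simp
    \<comment> \<open>Block \<open>j\<close> is the block on the times \<open>1, ..., l\<close> read
      along a shifted path, and all shifted paths have the same law.\<close>
    have *: "(\<integral>\<^sup>+ x. ?G (\<lambda>u. \<eta> (u + h) x) \<partial>M) = (\<integral>\<^sup>+ y. ?G y \<partial>Pi\<^sub>M UNIV (\<lambda>_. distr M borel (\<eta> 0)))" for h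
      unfolding path_distr[of h, symmetric] by (subst nn_integral_distr) auto
    have "X j x = N (noise_prod (\<lambda>u. \<eta> (u + (t - int (j * l) - int l)) x) (int l) l)" for x
      using noise_prod_shift[of "noise x" "t - int (j * l) - int l" "int l" l] by (simp add: X_def)
    then have "(\<integral>\<^sup>+ x. ennreal (X j x powr s) \<partial>M) = (\<integral>\<^sup>+ x. ?G (\<lambda>u. \<eta> (u + 0) x) \<partial>M)"
      unfolding * by (simp add: *)
    then show ?thesis using moment by simp
  qed
  have indepX: "indep_vars (\<lambda>_. borel) X UNIV"
  proof -
    \<comment> \<open>The stretch of noise that block \<open>j\<close> depends on; disjoint
      stretches yield independent blocks.\<close>
    define I where "I j = {t - int (j * l) - int l<..t - int (j * l)}" for j
    have disj: "disjoint_family_on I UNIV"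
    proof -
      have "I i \<inter> I j = {}" if "i < j" for i j
      proof -
        have "int (i * l) + int l \<le> int (j * l)"
          using mult_le_mono1[of "Suc i" j l] that by (simp flip: of_nat_add of_nat_mult add: add.commute)
        then show ?thesis by (auto simp: I_def)
      qed
      then show ?thesis
        unfolding disjoint_family_on_def by (metis inf_commute linorder_neqE_nat)
    qed
    have "indep_vars (\<lambda>j. Pi\<^sub>M (I j) (\<lambda>_. borel)) (\<lambda>j x. restrict (\<lambda>i. \<eta> i x) (I j)) UNIV"
      by (rule indep_vars_restrict[OF indep _ disj]) simp
    then have "indep_vars (\<lambda>_. borel) (\<lambda>j x. N (noise_prod (restrict (\<lambda>i. \<eta> i x) (I j)) (t - int (j * l)) l)) UNIV"
      by (rule indep_vars_compose2) (auto intro!: measurable_noise_prod measurable_component_singleton simp: I_def)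
    moreover have "noise_prod (restrict (\<lambda>i. \<eta> i x) (I j)) (t - int (j * l)) l = noise_prod (noise x) (t - int (j * l)) l" for x j
      by (rule noise_prod_cong) (simp add: I_def)
    ultimately show ?thesis
      by (simp add: X_def[abs_def])
  qed
  obtain r where r: "0 < r" "r < 1" and decay: "AE x in M. \<exists>K. \<forall>m. (\<Prod>j<m. X j x) \<le> K * r ^ m"
    using AE_prod_geometric_decay[OF indepX _ s \<rho> momentX] matrix_norm_noise_prod_nonneg[OF norm]
    unfolding X_def by blast
  have one: "0 \<le> N (1\<^sub>m dim)"
    using norm by (simp add: matrix_norm_def)
  \<comment> \<open>The norm of the identity may exceed 1 and is kept as a constant factor.\<close>
  have block: "N (noise_prod (noise x) t (m * l)) \<le> N (1\<^sub>m dim) * (\<Prod>j<m. X j x)" for m x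
  proof (induction m)
    case (Suc m)
    have "N (noise_prod (noise x) t (Suc m * l)) \<le> N (noise_prod (noise x) t (m * l)) * X m x"
      using matrix_norm_noise_prod_add[OF norm, of "noise x" t "m * l" l] by (simp add: X_def add.commute)
    also have "\<dots> \<le> N (1\<^sub>m dim) * (\<Prod>j<m. X j x) * X m x"
      using Suc matrix_norm_noise_prod_nonneg[OF norm] by (intro mult_right_mono) (auto simp: X_def)
    finally show ?case by (simp add: mult.assoc)
  qed simp
  have "\<exists>D. \<forall>j<l. \<forall>y t. N (noise_prod y t j) \<le> D"
  proof -
    obtain D where D: "\<And>j y t. N (noise_prod y t j) \<le> D j"
      using matrix_norm_noise_prod_bounded[OF norm] by metis
    have "N (noise_prod y t j) \<le> Max (D ` {..<l})" if "j < l" for y t j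
      using D[of y t j] Max_ge[of "D ` {..<l}" "D j"] that by (auto intro: order_trans)
    then show ?thesis by blast
  qed
  then obtain D where D: "\<And>j y t. j < l \<Longrightarrow> N (noise_prod y t j) \<le> D" by blast
  have D0: "0 \<le> D"
    using D[of 0] l one by (auto intro: order_trans)
  obtain c where c: "c > 0" "\<And>A i j. A \<in> carrier_mat dim dim \<Longrightarrow> i < dim \<Longrightarrow> j < dim \<Longrightarrow> \<bar>A $$ (i, j)\<bar> \<le> c * N A"
    using matrix_norm_entry_bound[OF norm] by blast
  show ?thesis
    using decay
  proof eventually_elim
    case (elim x)
    then obtain K where K: "\<And>m. (\<Prod>j<m. X j x) \<le> K * r ^ m" by blast
    have "\<exists>K r. 0 < r \<and> r < 1 \<and> (\<forall>k. N (noise_prod (noise x) t k) \<le> K * r ^ k)"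
    proof (rule geometric_bound_from_blocks[where l = l and K = "N (1\<^sub>m dim) * K" and D = D, OF _ r])
      show "N (noise_prod (noise x) t (m * l)) \<le> N (1\<^sub>m dim) * K * r ^ m" for m
        using block[of x m] mult_left_mono[OF K one, of m] by (simp add: mult.assoc)
      show "N (noise_prod (noise x) t (k + j)) \<le> N (noise_prod (noise x) t k) * D" if "j < l" for k j
        using matrix_norm_noise_prod_add[OF norm, of "noise x" t k j]
          mult_left_mono[OF D[OF that] matrix_norm_noise_prod_nonneg[OF norm]] by (rule order_trans)
    qed (use l D0 matrix_norm_noise_prod_nonneg[OF norm] in auto)
    then obtain K' r' where r': "0 < r'" "r' < 1" "\<And>k. N (noise_prod (noise x) t k) \<le> K' * r' ^ k"
      by blast
    have "\<bar>noise_prod (noise x) t k $$ (i, j)\<bar> \<le> c * K' * r' ^ k" if "i < dim" "j < dim" for k i j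
      using order_trans[OF c(2)[OF noise_prod_carrier that] mult_left_mono[OF r'(3)]] c(1)
      by (simp add: mult.assoc)
    then show ?case using r' by blast
  qed
qed

lemma AE_regular: "AE x in M. regular (noise x)"
proof -
  have "AE x in M. \<forall>t. \<exists>K r. 0 < r \<and> r < 1 \<and>
      (\<forall>k. \<forall>i<dim. \<forall>j<dim. \<bar>noise_prod (noise x) t k $$ (i, j)\<bar> \<le> K * r ^ k)"
    using AE_noise_prod_geometric by (subst AE_all_countable) blast
  then show ?thesis
    using AE_noise_nonzero AE_log_noise_subexponential
    by eventually_elim (simp add: regular_def)
qed

end

section \<open>Uniqueness of the stationary solution\<close>

context as_log_garch_model
begin

lemma as_log_garch_solution_iff:
  "as_log_garch_solution M p q \<omega> \<omega>m \<alpha>p \<alpha>m \<beta> \<eta> e \<longleftrightarrow>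
    (\<forall>t. e t \<in> borel_measurable M) \<and>
    (\<exists>s. (\<forall>t. s t \<in> borel_measurable M) \<and> (AE x in M. solves (noise x) (\<lambda>t. e t x) (\<lambda>t. s t x)))"
  unfolding as_log_garch_solution_def solves_def by (rule refl)

text \<open>The difference of two solutions satisfies \<open>d\<^sub>t = C\<^sub>t \<cdots> C\<^sub>t\<^sub>-\<^sub>k\<^sub>+\<^sub>1 d\<^sub>t\<^sub>-\<^sub>k\<close>, where the products tend to \<open>0\<close>
  almost surely. Only the marginals of \<open>e\<close> are known to be time invariant, not those of \<open>s\<close>; but
  \<open>log s\<^sup>2 = log e\<^sup>2 - log \<eta>\<^sup>2\<close> is a difference of two tight families, so \<open>d\<^sub>t\<^sub>-\<^sub>k\<close> is tight in \<open>k\<close>.\<close>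

lemma AE_solutions_state_eq:
  fixes e e' s s' :: "int \<Rightarrow> 'a \<Rightarrow> real"
  assumes [measurable]: "\<And>t. e t \<in> borel_measurable M" "\<And>t. s t \<in> borel_measurable M"
      "\<And>t. e' t \<in> borel_measurable M" "\<And>t. s' t \<in> borel_measurable M"
    and sol: "AE x in M. solves (noise x) (\<lambda>t. e t x) (\<lambda>t. s t x)"
      "AE x in M. solves (noise x) (\<lambda>t. e' t x) (\<lambda>t. s' t x)"
    and ident_sol: "\<And>t. distr M borel (e t) = distr M borel (e 0)" "\<And>t. distr M borel (e' t) = distr M borel (e' 0)"
    and i: "i < dim"
  shows "AE x in M. sol_state (\<lambda>t. e t x) (\<lambda>t. s t x) t i = sol_state (\<lambda>t. e' t x) (\<lambda>t. s' t x) t i"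
proof -
  define w where "w t i x = sol_state (\<lambda>t. e t x) (\<lambda>t. s t x) t i" for t i x
  define w' where "w' t i x = sol_state (\<lambda>t. e' t x) (\<lambda>t. s' t x) t i" for t i x
  define d where "d t i x = w t i x - w' t i x" for t i x
  have [measurable]: "w t i \<in> borel_measurable M" "w' t i \<in> borel_measurable M" for t i
    unfolding w_def w'_def by (rule measurable_sol_state; simp)+
  have [measurable]: "d t i \<in> borel_measurable M" for t i
    unfolding d_def by measurable
  have "AE x in M. \<forall>k. \<forall>i<dim. d t i x = mat_apply dim (noise_prod (noise x) t k) (\<lambda>j. d (t - int k) j x) i" for t
    using sol AE_noise_nonzero
  proof eventually_elim
    case (elim x)
    have rec: "d t i x = mat_apply dim (coef_mat (\<eta> t x)) (\<lambda>j. d (t - 1) j x) i" if "i < dim" for t i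
      using sol_state_rec[OF elim(1) _ that, of t] sol_state_rec[OF elim(2) _ that, of t] elim(3)
      unfolding d_def w_def w'_def mat_apply_diff by simp
    have "d t i x = mat_apply dim (noise_prod (noise x) t k) (\<lambda>j. d (t - int k) j x) i" if "i < dim" for t i k
      using that
    proof (induction k arbitrary: t i)
      case (Suc k)
      have "d t i x = mat_apply dim (coef_mat (\<eta> t x))
          (mat_apply dim (noise_prod (noise x) (t - 1) k) (\<lambda>j. d (t - 1 - int k) j x)) i"
        unfolding rec[OF Suc.prems] by (rule fun_cong[OF mat_apply_cong]) (rule Suc.IH)
      also have "\<dots> = mat_apply dim (noise_prod (noise x) t (Suc k)) (\<lambda>j. d (t - 1 - int k) j x) i"
        using mat_apply_mult[OF coef_mat_carrier noise_prod_carrier Suc.prems] by simp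
      finally show ?case by (simp add: algebra_simps)
    qed (simp add: mat_apply_one)
    then show ?case by blast
  qed
  note iter = this
  \<comment> \<open>Bounds the probability that a component of the difference exceeds
    \<open>4 * L\<close>, at any time: two states, each bounded by two logarithms. The noise enters
    once per solution, hence the factor 2.\<close>
  define tail where "tail L = prob {x \<in> space M. real L < \<bar>ln ((e 0 x)\<^sup>2)\<bar>}
    + prob {x \<in> space M. real L < \<bar>ln ((e' 0 x)\<^sup>2)\<bar>}
    + 2 * prob {x \<in> space M. real L < \<bar>ln ((\<eta> 0 x)\<^sup>2)\<bar>}" for L
  have tail_tendsto: "(\<lambda>L. real dim * tail L) \<longlonglongrightarrow> 0"
  proof -
    have "tail \<longlonglongrightarrow> 0 + 0 + 2 * 0"
      unfolding tail_def[abs_def]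
      by (intro tendsto_add tendsto_mult tendsto_const prob_abs_gt_tendsto_0) measurable
    then show ?thesis
      by (intro tendsto_mult_right_zero) simp
  qed
  have tight1: "prob {x \<in> space M. 2 * real L < \<bar>sol_state (\<lambda>t. f t x) (\<lambda>t. g t x) u i\<bar>}
      \<le> prob {x \<in> space M. real L < \<bar>ln ((f 0 x)\<^sup>2)\<bar>} + prob {x \<in> space M. real L < \<bar>ln ((\<eta> 0 x)\<^sup>2)\<bar>}"
    if [measurable]: "\<And>t. f t \<in> borel_measurable M" "\<And>t. g t \<in> borel_measurable M"
      and f: "\<And>t. distr M borel (f t) = distr M borel (f 0)"
      and sol: "AE x in M. solves (noise x) (\<lambda>t. f t x) (\<lambda>t. g t x)" for f g L u i
  proof -
    obtain j where j: "\<And>y e s t. solves y e s \<Longrightarrow> (\<forall>u. y u \<noteq> 0) \<Longrightarrow>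
        \<bar>sol_state e s t i\<bar> \<le> \<bar>ln ((e (t - int j))\<^sup>2)\<bar> + \<bar>ln ((y (t - int j))\<^sup>2)\<bar>"
      using solves_abs_sol_state_le[of i] by blast
    let ?A = "\<lambda>v. {x \<in> space M. real L < \<bar>ln ((f v x)\<^sup>2)\<bar>}"
    let ?B = "\<lambda>v. {x \<in> space M. real L < \<bar>ln ((\<eta> v x)\<^sup>2)\<bar>}"
    have "AE x in M. x \<in> {x \<in> space M. 2 * real L < \<bar>sol_state (\<lambda>t. f t x) (\<lambda>t. g t x) u i\<bar>}
        \<longrightarrow> x \<in> ?A (u - int j) \<union> ?B (u - int j)"
      using sol AE_noise_nonzero
    proof eventually_elim
      case (elim x)
      from j[OF this, of u] show ?case by auto
    qed
    then have "prob {x \<in> space M. 2 * real L < \<bar>sol_state (\<lambda>t. f t x) (\<lambda>t. g t x) u i\<bar>}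
        \<le> prob (?A (u - int j) \<union> ?B (u - int j))"
      by (intro finite_measure_mono_AE) measurable
    also have "\<dots> \<le> prob (?A (u - int j)) + prob (?B (u - int j))"
      by (intro measure_Un_le) measurable
    also have "prob (?A (u - int j)) = prob (?A 0)"
      by (rule prob_abs_gt_identically_distributed[where g = "\<lambda>z. ln (z\<^sup>2)"]) (auto intro: f)
    also have "prob (?B (u - int j)) = prob (?B 0)"
      by (rule prob_abs_gt_identically_distributed[where g = "\<lambda>z. ln (z\<^sup>2)"]) (auto intro: ident)
    finally show ?thesis .
  qed
  have tight: "prob {x \<in> space M. 4 * real L < \<bar>d u i x\<bar>} \<le> tail L" for L u i
  proof -
    have "prob {x \<in> space M. 4 * real L < \<bar>d u i x\<bar>}
        \<le> prob ({x \<in> space M. 2 * real L < \<bar>w u i x\<bar>} \<union> {x \<in> space M. 2 * real L < \<bar>w' u i x\<bar>})"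
      by (intro finite_measure_mono) (auto simp: d_def)
    also have "\<dots> \<le> prob {x \<in> space M. 2 * real L < \<bar>w u i x\<bar>} + prob {x \<in> space M. 2 * real L < \<bar>w' u i x\<bar>}"
      by (intro measure_Un_le) measurable
    also have "\<dots> \<le> tail L"
      using tight1[of e s L u i] tight1[of e' s' L u i] ident_sol sol
      unfolding w_def w'_def tail_def by simp
    finally show ?thesis .
  qed
  \<comment> \<open>A single real random variable that dominates all entries of the product.\<close>
  define R where "R k x = (\<Sum>i<dim. \<Sum>j<dim. \<bar>noise_prod (noise x) t k $$ (i, j)\<bar>)" for k x
  have [measurable]: "(\<lambda>x. noise_prod (noise x) t k $$ (i, j)) \<in> borel_measurable M" for k i j
    by (rule measurable_noise_prod) simp
  have [measurable]: "R k \<in> borel_measurable M" for k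
    unfolding R_def by measurable
  have R_nonneg: "0 \<le> R k x" for k x
    by (simp add: R_def sum_nonneg)
  have R: "\<bar>noise_prod (noise x) t k $$ (i, j)\<bar> \<le> R k x" if "i < dim" "j < dim" for i j k x
  proof -
    have "\<bar>noise_prod (noise x) t k $$ (i, j)\<bar> \<le> (\<Sum>j<dim. \<bar>noise_prod (noise x) t k $$ (i, j)\<bar>)"
      using that by (intro member_le_sum) auto
    also have "\<dots> \<le> R k x"
      unfolding R_def using that
      by (intro member_le_sum[where f = "\<lambda>i. \<Sum>j<dim. \<bar>noise_prod (noise x) t k $$ (i, j)\<bar>"]) (auto intro: sum_nonneg)
    finally show ?thesis .
  qed
  have R_tendsto: "AE x in M. (\<lambda>k. R k x) \<longlonglongrightarrow> 0"
    using AE_noise_prod_geometric[of t]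
  proof eventually_elim
    case (elim x)
    then obtain K r where r: "0 < r" "r < 1"
      and K: "\<And>k i j. i < dim \<Longrightarrow> j < dim \<Longrightarrow> \<bar>noise_prod (noise x) t k $$ (i, j)\<bar> \<le> K * r ^ k"
      by blast
    have lim: "(\<lambda>k. K * r ^ k) \<longlonglongrightarrow> 0"
      using r by (intro tendsto_mult_right_zero LIMSEQ_power_zero) simp
    have "(\<lambda>k. \<bar>noise_prod (noise x) t k $$ (i, j)\<bar>) \<longlonglongrightarrow> 0" if "i < dim" "j < dim" for i j
      by (rule tendsto_sandwich[OF _ _ tendsto_const lim]) (use K that in auto)
    then show ?case
      unfolding R_def by (intro tendsto_null_sum) auto
  qed
  \<comment> \<open>For fixed \<open>L\<close> the product tends to 0 as \<open>k\<close> grows, by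
    dominated convergence, while the tail term does not depend on \<open>k\<close>. Afterwards
    \<open>L\<close> tends to infinity.\<close>
  have E_small: "expectation (\<lambda>x. min 1 \<bar>d t i x\<bar>) \<le> real dim * tail L" for L
  proof -
    define b where "b k x = min 1 (real dim * (R k x * (4 * real L)))" for k x
    have [measurable]: "b k \<in> borel_measurable M" for k
      unfolding b_def by measurable
    have "(\<lambda>k. expectation (b k)) \<longlonglongrightarrow> expectation (\<lambda>x. 0)"
    proof (rule integral_dominated_convergence[where w = "\<lambda>_. 1"])
      show "AE x in M. (\<lambda>k. b k x) \<longlonglongrightarrow> 0"
        using R_tendsto
      proof eventually_elim
        case (elim x)
        then have "(\<lambda>k. min 1 (real dim * (R k x * (4 * real L)))) \<longlonglongrightarrow> min 1 (real dim * (0 * (4 * real L)))"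
          by (intro tendsto_intros)
        then show ?case by (simp add: b_def)
      qed
      show "AE x in M. norm (b k x) \<le> 1" for k
        using R_nonneg by (simp add: b_def)
    qed auto
    then have lim: "(\<lambda>k. expectation (b k) + real dim * tail L) \<longlonglongrightarrow> 0 + real dim * tail L"
      by (intro tendsto_intros) simp
    have "expectation (\<lambda>x. min 1 \<bar>d t i x\<bar>) \<le> expectation (b k) + real dim * tail L" for k
    proof -
      let ?S = "\<lambda>j. {x \<in> space M. 4 * real L < \<bar>d (t - int k) j x\<bar>}"
      have int: "integrable M (b k)"
        using R_nonneg by (intro integrable_const_bound[where B = 1]) (auto simp: b_def)
      have "expectation (\<lambda>x. min 1 \<bar>d t i x\<bar>) \<le> expectation (\<lambda>x. b k x + (\<Sum>j<dim. indicator (?S j) x))"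
      proof (rule integral_mono_AE)
        show "integrable M (\<lambda>x. min 1 \<bar>d t i x\<bar>)"
          by (intro integrable_const_bound[where B = 1]) auto
        show "integrable M (\<lambda>x. b k x + (\<Sum>j<dim. indicator (?S j) x))"
          by (intro Bochner_Integration.integrable_add int Bochner_Integration.integrable_sum
              integrable_real_indicator) (auto simp: emeasure_eq_measure)
        \<comment> \<open>Either some component of the earlier difference exceeds
          \<open>4 * L\<close> and the indicators sum to at least 1, or the iterated recursion
          bounds the present difference.\<close>
        show "AE x in M. min 1 \<bar>d t i x\<bar> \<le> b k x + (\<Sum>j<dim. indicator (?S j) x)"
          using iter[of t] AE_space
        proof eventually_elim
          case (elim x)
          have b: "0 \<le> b k x"
            using R_nonneg by (simp add: b_def)
          show ?case
          proof (cases "\<exists>j<dim. x \<in> ?S j")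
            case True
            then obtain j where j: "j < dim" "x \<in> ?S j" by blast
            have "(1 :: real) \<le> (\<Sum>j<dim. indicator (?S j) x)"
              using member_le_sum[of j "{..<dim}" "\<lambda>j. indicator (?S j) x :: real"] j by simp
            then show ?thesis using b by linarith
          next
            case False
            have le: "\<bar>d (t - int k) j x\<bar> \<le> 4 * real L" if "j < dim" for j
            proof (rule ccontr)
              assume "\<not> ?thesis"
              then have "x \<in> ?S j"
                using elim(2) by simp
              with False that show False by blast
            qed
            have "\<bar>d t i x\<bar> \<le> real dim * (R k x * (4 * real L))"
              using abs_mat_apply_le[of dim "noise_prod (noise x) t k" i, OF R[OF i] le] elim(1)[rule_format, OF i, of k] by simp
            then have "min 1 \<bar>d t i x\<bar> \<le> b k x"
              by (auto simp: b_def)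
            moreover have "(0 :: real) \<le> (\<Sum>j<dim. indicator (?S j) x)"
              by (intro sum_nonneg) auto
            ultimately show ?thesis by linarith
          qed
        qed
      qed
      also have "\<dots> = expectation (b k) + (\<Sum>j<dim. prob (?S j))"
        using int by (subst Bochner_Integration.integral_add)
          (auto intro!: Bochner_Integration.integrable_sum integrable_real_indicator simp: emeasure_eq_measure)
      also have "(\<Sum>j<dim. prob (?S j)) \<le> (\<Sum>j<dim. tail L)"
        by (intro sum_mono tight)
      finally show ?thesis by simp
    qed
    then show ?thesis
      using LIMSEQ_le_const[OF lim] by auto
  qed
  have "expectation (\<lambda>x. min 1 \<bar>d t i x\<bar>) \<le> 0"
    using LIMSEQ_le_const[OF tail_tendsto] E_small by blast
  then have "expectation (\<lambda>x. min 1 \<bar>d t i x\<bar>) = 0"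
    by (intro antisym integral_nonneg_AE) auto
  then have "AE x in M. min 1 \<bar>d t i x\<bar> = 0"
    by (subst (asm) integral_nonneg_eq_0_iff_AE) (auto intro!: integrable_const_bound[where B = 1])
  then show ?thesis
    by eventually_elim (auto simp: d_def w_def w'_def min_def split: if_splits)
qed

text \<open>Component \<open>2 * q\<close> determines the positive volatility and hence
  \<open>e = s * \<eta>\<close>; countably many times leave a single null set.\<close>

lemma stationary_solution_unique:
  assumes e: "as_log_garch_solution M p q \<omega> \<omega>m \<alpha>p \<alpha>m \<beta> \<eta> e" "strictly_stationary M e"
    and e': "as_log_garch_solution M p q \<omega> \<omega>m \<alpha>p \<alpha>m \<beta> \<eta> e'" "strictly_stationary M e'"
  shows "AE x in M. \<forall>t. e t x = e' t x"
proof -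
  have *: "\<exists>s. (\<forall>t. s t \<in> borel_measurable M) \<and> (AE x in M. solves (noise x) (\<lambda>t. f t x) (\<lambda>t. s t x))"
    "f t \<in> borel_measurable M"
    if "as_log_garch_solution M p q \<omega> \<omega>m \<alpha>p \<alpha>m \<beta> \<eta> f" for f t
    using that unfolding as_log_garch_solution_iff by simp_all
  obtain s where s: "\<And>t. s t \<in> borel_measurable M" "AE x in M. solves (noise x) (\<lambda>t. e t x) (\<lambda>t. s t x)"
    using *(1)[OF e(1)] by blast
  obtain s' where s': "\<And>t. s' t \<in> borel_measurable M" "AE x in M. solves (noise x) (\<lambda>t. e' t x) (\<lambda>t. s' t x)"
    using *(1)[OF e'(1)] by blast
  have "AE x in M. sol_state (\<lambda>t. e t x) (\<lambda>t. s t x) t (2 * q) = sol_state (\<lambda>t. e' t x) (\<lambda>t. s' t x) t (2 * q)" for t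
    using p_pos
    by (intro AE_solutions_state_eq *(2)[OF e(1)] *(2)[OF e'(1)] s s'
        strictly_stationary_distr e(2) e'(2)) simp
  then have "AE x in M. \<forall>t. sol_state (\<lambda>t. e t x) (\<lambda>t. s t x) t (2 * q) = sol_state (\<lambda>t. e' t x) (\<lambda>t. s' t x) t (2 * q)"
    by (subst AE_all_countable) blast
  then show ?thesis
    using s(2) s'(2)
  proof eventually_elim
    case (elim x)
    show ?case
    proof
      fix t
      have pos: "s t x > 0" "s' t x > 0" and eq: "e t x = s t x * \<eta> t x" "e' t x = s' t x * \<eta> t x"
        using elim(2,3) by (auto simp: solves_def)
      have "ln ((s t x)\<^sup>2) = ln ((s' t x)\<^sup>2)"
        using elim(1)[rule_format, of t] by (simp add: sol_state_def)
      then have "s t x = s' t x"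
        using pos by (simp add: ln_realpow)
      then show "e t x = e' t x"
        by (simp add: eq)
    qed
  qed
qed

section \<open>The stationary solution as a function of the noise\<close>

abbreviation solution :: "int \<Rightarrow> 'a \<Rightarrow> real" where
  "solution t x \<equiv> sol (noise x) t"

lemma solution_solves: "as_log_garch_solution M p q \<omega> \<omega>m \<alpha>p \<alpha>m \<beta> \<eta> solution"
proof -
  have "AE x in M. solves (noise x) (\<lambda>t. solution t x) (\<lambda>t. vol (noise x) t)"
    using AE_regular by eventually_elim (rule solves_sol)
  moreover have "solution t \<in> borel_measurable M" "(\<lambda>x. vol (noise x) t) \<in> borel_measurable M" for t
    by (rule measurable_sol measurable_vol; simp)+
  ultimately show ?thesis
    unfolding as_log_garch_solution_iff by (intro conjI exI[of _ "\<lambda>t x. vol (noise x) t"]) auto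
qed

lemma solution_non_anticipative: "non_anticipative M \<eta> solution"
  unfolding non_anticipative_def
proof
  fix t
  show "solution t \<in> borel_measurable (SUP u\<in>{..t}. vimage_algebra (space M) (\<eta> u) borel)"
  proof (rule measurable_sol)
    fix u assume "u \<le> t"
    then show "\<eta> u \<in> borel_measurable (SUP u\<in>{..t}. vimage_algebra (space M) (\<eta> u) borel)"
      by (intro measurable_SUP1[of u]) (auto intro: measurable_vimage_algebra1)
  qed
qed

lemma sol_path_measurable: "(\<lambda>y t. sol y t) \<in> measurable (Pi\<^sub>M UNIV (\<lambda>_. borel)) (Pi\<^sub>M UNIV (\<lambda>_. borel))"
  by (rule measurable_PiM_single') (auto intro: measurable_sol simp: space_PiM)

text \<open>Stationarity is visible in the right-hand side, which is free of
  \<open>h\<close>.\<close>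

lemma solution_path_law:
  "path_law M (\<lambda>t. solution (t + h)) =
    distr (Pi\<^sub>M UNIV (\<lambda>_. distr M borel (\<eta> 0))) (Pi\<^sub>M UNIV (\<lambda>_. borel)) (\<lambda>y t. sol y t)"
  unfolding path_distr[of h, symmetric] path_law_def
  by (subst distr_distr[OF sol_path_measurable path_measurable])
    (simp add: comp_def sol_shift[where y = "\<lambda>t. \<eta> t x" for x])

lemma solution_stationary: "strictly_stationary M solution"
  using solution_path_law solution_path_law[of 0]
  by (auto simp: strictly_stationary_def intro: measurable_sol)

text \<open>By equivariance the preimage of a shift-invariant event under \<open>sol\<close> is a
  shift-invariant event of the noise, to which the zero-one law applies.\<close>

lemma solution_ergodic: "ergodic_process M solution"
  unfolding ergodic_process_def
proof (intro conjI ballI impI solution_stationary)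
  let ?D = "distr M borel (\<eta> 0)"
  fix A :: "(int \<Rightarrow> real) set"
  assume A: "A \<in> sets (Pi\<^sub>M UNIV (\<lambda>_. borel))" and inv: "(\<lambda>y t. y (t + 1)) -` A = A"
  define B where "B = (\<lambda>y t. sol y t) -` A"
  have sets: "sets (Pi\<^sub>M UNIV (\<lambda>_::int. ?D)) = sets (Pi\<^sub>M UNIV (\<lambda>_::int. borel))"
    by (rule sets_PiM_cong) simp_all
  have space: "space (Pi\<^sub>M UNIV (\<lambda>_::int. ?D)) = UNIV"
    by (simp add: space_PiM PiE_UNIV_domain)
  have meas: "(\<lambda>y t. sol y t) \<in> measurable (Pi\<^sub>M UNIV (\<lambda>_. ?D)) (Pi\<^sub>M UNIV (\<lambda>_. borel))"
    using sol_path_measurable by (simp add: measurable_cong_sets[OF sets refl])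
  have "measure (path_law M solution) A = measure (Pi\<^sub>M UNIV (\<lambda>_. ?D)) B"
    using solution_path_law[of 0] by (simp add: measure_distr[OF meas A] B_def space)
  moreover have "B \<in> sets (Pi\<^sub>M UNIV (\<lambda>_. ?D))"
    using measurable_sets[OF meas A] by (simp add: B_def space)
  moreover have "(\<lambda>y t. y (t + 1)) -` B = B"
  proof -
    have "(\<lambda>y t. y (t + 1)) -` B = (\<lambda>y t. sol y t) -` ((\<lambda>y t. y (t + 1)) -` A)"
      by (simp add: B_def vimage_def sol_shift[of _ 1])
    then show ?thesis
      by (simp add: inv B_def)
  qed
  ultimately show "measure (path_law M solution) A \<in> {0, 1}"
    using PiM_shift_invariant_0_1[of ?D B] by (simp add: prob_space_distr)
qed

end

theorem theorem1p1:
  fixes M :: "'a measure"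
    and p q :: nat
    and \<omega> :: real
    and \<omega>m \<alpha>p \<alpha>m \<beta> :: "nat \<Rightarrow> real"
    and \<eta> :: "int \<Rightarrow> 'a \<Rightarrow> real"
    and N :: "real mat \<Rightarrow> real"
  assumes "prob_space M"
    and "p > 1" and "q > 1"
    and "prob_space.indep_vars M (\<lambda>_. borel) \<eta> UNIV"
    and "\<And>t. distr M borel (\<eta> t) = distr M borel (\<eta> 0)"
    and "has_bochner_integral M (\<lambda>x. (\<eta> 1 x)\<^sup>2) 1"
    and "(\<integral>\<^sup>+ x. e2ennreal (ereal_log_plus \<bar>ereal_log (ereal ((\<eta> 0 x)\<^sup>2))\<bar>) \<partial>M) < \<infinity>"
    and "matrix_norm (2 * q + p) N"
    and "top_lyapunov M (2 * q + p) N (\<lambda>t x. as_log_garch_mat p q \<alpha>p \<alpha>m \<beta> (\<eta> t x)) < 0"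
  shows "\<exists>\<epsilon>. as_log_garch_solution M p q \<omega> \<omega>m \<alpha>p \<alpha>m \<beta> \<eta> \<epsilon>
            \<and> strictly_stationary M \<epsilon>
            \<and> non_anticipative M \<eta> \<epsilon>
            \<and> ergodic_process M \<epsilon>
            \<and> (\<forall>\<epsilon>'. as_log_garch_solution M p q \<omega> \<omega>m \<alpha>p \<alpha>m \<beta> \<eta> \<epsilon>' \<and> strictly_stationary M \<epsilon>'
                   \<longrightarrow> (AE x in M. \<forall>t. \<epsilon>' t x = \<epsilon> t x))"
proof -
  interpret prob_space M by fact
  interpret as_log_garch_model p q \<omega> \<omega>m \<alpha>p \<alpha>m \<beta> M \<eta> N
    using assms by unfold_locales auto
  show ?thesis
    using solution_solves solution_stationary solution_non_anticipative solution_ergodic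
      stationary_solution_unique
    by blast
qed

end
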